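(* Let $Y$ be a random vector in $\mathbb{R}^d$ following a distribution $P_\theta$ of the natural exponential family with natural parameter $\theta\in\mathbb{R}^d$, i.e. with density $p(y;\theta)=h(y)\exp(\langle y,\theta\rangle-A(\theta))$ with respect to the Lebesgue measure on $\mathbb{R}^d$. Assume that $y\mapsto\hat\mu(y)$ is weakly differentiable with essentially bounded weak partial derivatives on $\mathbb{R}^d$. Then, provided $h$ is weakly differentiable on $\mathbb{R}^d$, the quantity $$\mathrm{SUKLS}=\Big\langle \hat\theta(Y)+\frac{\nabla h(Y)}{h(Y)},\ \hat\mu(Y)\Big\rangle+\operatorname{tr}\Big(\frac{\partial\hat\mu(y)}{\partial y}\Big|_{y=Y}\Big)-A(\hat\theta(Y)),$$ where $\hat\theta(Y)=\phi(\hat\mu(Y))$, is an unbiased estimator of $\mathrm{MKLS}-A(\theta)$, where $\mathrm{MKLS}=\mathbb{E}\big[D(P_{\hat\theta(Y)}\,\|\,P_\theta)\big]$; that is, $\mathbb{E}[\mathrm{SUKLS}]=\mathrm{MKLS}-A(\theta)$.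
   Context: In the natural exponential family, $h:\mathbb{R}^d\to\mathbb{R}^+$ is the base measure and $A:\mathbb{R}^d\to\mathbb{R}$ is the (convex) log-partition function, with $\mathbb{E}[Y]=\nabla A(\theta)$. The statistic $Y$ is taken to be minimal sufficient, so $\nabla A$ is one-to-one, and $\phi:\mathbb{R}^d\to\mathbb{R}^d$ is the canonical link function $\phi=(\nabla A)^{-1}$; thus $\theta=\phi(\mu)$ with $\mu=\mathbb{E}[Y]$. The function $\hat\mu$ is a predictor of the unknown $\mu\in\mathbb{R}^d$ that depends on $Y$ only, and $\hat\theta=\phi\circ\hat\mu$, so that $\nabla A(\hat\theta(Y))=\hat\mu(Y)$. Expectations $\mathbb{E}$ are with respect to $Y\sim P_\theta$. $D(P_0\|P_1)=\int \log\frac{dP_0}{dP_1}\,dP_0$ is the Kullback-Leibler divergence; for two members of the same natural exponential family with parameters $\theta_0,\theta_1$ it equals $A(\theta_1)-A(\theta_0)-\langle\nabla A(\theta_0),\theta_1-\theta_0\rangle$. In $D(P_{\hat\theta(Y)}\|P_\theta)$ this divergence is evaluated at the random parameter $\hat\theta(Y)$. $\mathrm{MKLS}$ is called the mean Kullback-Leibler synthesis loss. $\frac{\partial\hat\mu(y)}{\partial y}$ denotes the $d\times d$ (weak) Jacobian of $\hat\mu$, and $\nabla h$ the (weak) gradient of $h$.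
   Formalization: The formal theorem assumes that E[SUKLS] exists (its positive and negative parts are not both infinite; infinite values allowed); without this it can be ∞−∞, e.g. d=1, h(y)=exp(−y²)(2+sin exp(y⁴)), μ̂(y)=y. *)

theory Defs
  imports "HOL-Probability.Probability"
begin

subsection \<open>Weak derivatives on Euclidean space\<close>

definition partial_deriv :: "'d \<Rightarrow> (real^'d \<Rightarrow> real) \<Rightarrow> real^'d \<Rightarrow> real" where
  "partial_deriv j f x = frechet_derivative f (at x) (axis j 1)"

primrec Ck :: "nat \<Rightarrow> (real^'d \<Rightarrow> real) \<Rightarrow> bool" where
  "Ck 0 f \<longleftrightarrow> continuous_on UNIV f"
| "Ck (Suc k) f \<longleftrightarrow> f differentiable_on UNIV \<and> (\<forall>j. Ck k (partial_deriv j f))"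

definition test_function :: "(real^'d \<Rightarrow> real) \<Rightarrow> bool" where
  "test_function \<psi> \<longleftrightarrow> (\<forall>k. Ck k \<psi>) \<and> compact (closure {x. \<psi> x \<noteq> 0})"

definition locally_integrable :: "(real^'d \<Rightarrow> real) \<Rightarrow> bool" where
  "locally_integrable f \<longleftrightarrow> (\<forall>K. compact K \<longrightarrow> set_integrable lborel K f)"

definition has_weak_partial_deriv :: "'d \<Rightarrow> (real^'d \<Rightarrow> real) \<Rightarrow> (real^'d \<Rightarrow> real) \<Rightarrow> bool" where
  "has_weak_partial_deriv j f g \<longleftrightarrow>
     locally_integrable f \<and> locally_integrable g \<and>
     (\<forall>\<psi>. test_function \<psi> \<longrightarrow>
        (LINT x|lborel. f x * partial_deriv j \<psi> x) = - (LINT x|lborel. g x * \<psi> x))"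

definition has_weak_gradient :: "(real^'d \<Rightarrow> real) \<Rightarrow> (real^'d \<Rightarrow> real^'d) \<Rightarrow> bool" where
  "has_weak_gradient f G \<longleftrightarrow> (\<forall>j. has_weak_partial_deriv j f (\<lambda>x. G x $ j))"

text \<open>The entry \<open>J x $ i $ j\<close> is the weak derivative of the \<open>i\<close>-th component in direction \<open>j\<close>.\<close>

definition has_weak_jacobian :: "(real^'d \<Rightarrow> real^'d) \<Rightarrow> (real^'d \<Rightarrow> real^'d^'d) \<Rightarrow> bool" where
  "has_weak_jacobian F J \<longleftrightarrow> (\<forall>i. has_weak_gradient (\<lambda>x. F x $ i) (\<lambda>x. J x $ i))"

definition essentially_bounded :: "(real^'d \<Rightarrow> real) \<Rightarrow> bool" where
  "essentially_bounded f \<longleftrightarrow> f \<in> borel_measurable borel \<and> (\<exists>C. AE x in lborel. \<bar>f x\<bar> \<le> C)"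


subsection \<open>Natural exponential families\<close>

definition nef_density :: "(real^'d \<Rightarrow> real) \<Rightarrow> (real^'d \<Rightarrow> real) \<Rightarrow> real^'d \<Rightarrow> real^'d \<Rightarrow> real" where
  "nef_density h A \<theta> y = h y * exp (y \<bullet> \<theta> - A \<theta>)"

definition nef :: "(real^'d \<Rightarrow> real) \<Rightarrow> (real^'d \<Rightarrow> real) \<Rightarrow> real^'d \<Rightarrow> (real^'d) measure" where
  "nef h A \<theta> = density lborel (\<lambda>y. ennreal (nef_density h A \<theta> y))"

text \<open>Requiring every \<open>nef h A \<theta>\<close> to be a probability measure forces
  \<open>A \<theta> = ln (\<integral> h y * exp (y \<bullet> \<theta>) dy)\<close>, i.e. \<open>A\<close> is the log-partition function;
  as \<open>A\<close> is real-valued on the whole space, the natural parameter space is the whole space.\<close>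

definition natural_exponential_family :: "(real^'d \<Rightarrow> real) \<Rightarrow> (real^'d \<Rightarrow> real) \<Rightarrow> bool" where
  "natural_exponential_family h A \<longleftrightarrow>
     h \<in> borel_measurable borel \<and> (\<forall>y. 0 \<le> h y) \<and> (\<forall>\<theta>. prob_space (nef h A \<theta>))"

definition gradient :: "(real^'d \<Rightarrow> real) \<Rightarrow> real^'d \<Rightarrow> real^'d" where
  "gradient f x = (THE D. GDERIV f x :> D)"

definition canonical_link :: "(real^'d \<Rightarrow> real) \<Rightarrow> real^'d \<Rightarrow> real^'d" where
  "canonical_link A = inv (gradient A)"


subsection \<open>Losses and estimators\<close>

text \<open>The expectation \<open>E[X] = E[X\<^sup>+] - E[X\<^sup>-]\<close> in the extended reals, which exists
  as soon as one of the two parts is finite. The Bochner integral would return \<open>0\<close> for a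
  non-integrable \<open>X\<close>; for an integrable \<open>X\<close> the two agree.\<close>

definition has_expectation :: "'w measure \<Rightarrow> ('w \<Rightarrow> real) \<Rightarrow> bool" where
  "has_expectation M X \<longleftrightarrow> X \<in> borel_measurable M \<and>
     ((\<integral>\<^sup>+ \<omega>. ennreal (X \<omega>) \<partial>M) < \<infinity> \<or> (\<integral>\<^sup>+ \<omega>. ennreal (- X \<omega>) \<partial>M) < \<infinity>)"

definition ext_expectation :: "'w measure \<Rightarrow> ('w \<Rightarrow> real) \<Rightarrow> ereal" where
  "ext_expectation M X =
     enn2ereal (\<integral>\<^sup>+ \<omega>. ennreal (X \<omega>) \<partial>M) - enn2ereal (\<integral>\<^sup>+ \<omega>. ennreal (- X \<omega>) \<partial>M)"

lemma ext_expectation_integrable: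
  assumes "integrable M X"
  shows "has_expectation M X" and "ext_expectation M X = ereal (LINT \<omega>|M. X \<omega>)"
proof -
  from assms obtain r q where rq: "0 \<le> r" "0 \<le> q"
    "(\<integral>\<^sup>+ \<omega>. ennreal (X \<omega>) \<partial>M) = ennreal r" "(\<integral>\<^sup>+ \<omega>. ennreal (- X \<omega>) \<partial>M) = ennreal q"
    "(LINT \<omega>|M. X \<omega>) = r - q"
    by (rule integrableE)
  show "has_expectation M X"
    using assms rq by (simp add: has_expectation_def)
  show "ext_expectation M X = ereal (LINT \<omega>|M. X \<omega>)"
    using rq by (simp add: ext_expectation_def enn2ereal_ennreal)
qed

text \<open>Note that \<open>KL_divergence b M N\<close> is the divergence of \<open>N\<close> from the reference measure \<open>M\<close>,
  i.e. \<open>D(N \<parallel> M)\<close> with logarithms to base \<open>b\<close>.\<close>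

definition nef_KL :: "(real^'d \<Rightarrow> real) \<Rightarrow> (real^'d \<Rightarrow> real) \<Rightarrow> real^'d \<Rightarrow> real^'d \<Rightarrow> real" where
  "nef_KL h A \<theta>0 \<theta>1 = KL_divergence (exp 1) (nef h A \<theta>1) (nef h A \<theta>0)"

definition MKLS :: "'w measure \<Rightarrow> ('w \<Rightarrow> real^'d) \<Rightarrow> (real^'d \<Rightarrow> real) \<Rightarrow> (real^'d \<Rightarrow> real)
    \<Rightarrow> (real^'d \<Rightarrow> real^'d) \<Rightarrow> real^'d \<Rightarrow> ereal" where
  "MKLS M Y h A muhat \<theta> =
     ext_expectation M (\<lambda>\<omega>. nef_KL h A (canonical_link A (muhat (Y \<omega>))) \<theta>)"

text \<open>Where \<open>h y = 0\<close> the quotient is \<open>0\<close> by convention; this set is null under every \<open>nef h A \<theta>\<close>.\<close>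

definition SUKLS :: "(real^'d \<Rightarrow> real) \<Rightarrow> (real^'d \<Rightarrow> real^'d) \<Rightarrow> (real^'d \<Rightarrow> real)
    \<Rightarrow> (real^'d \<Rightarrow> real^'d) \<Rightarrow> (real^'d \<Rightarrow> real^'d^'d) \<Rightarrow> real^'d \<Rightarrow> real" where
  "SUKLS h Dh A muhat J y =
     (canonical_link A (muhat y) + (1 / h y) *\<^sub>R Dh y) \<bullet> muhat y
       + trace (J y) - A (canonical_link A (muhat y))"

end

theory Submission
  imports Defs
begin

text \<open>Write \<open>Z = (\<nabla>h / h + \<theta>) \<bullet> muhat + tr J\<close>. Since the divergence \<open>D\<close> from \<open>P\<^sub>\<theta>\<close> is a Bregman
  divergence of \<open>A\<close> and the gradient of \<open>A\<close> at the estimate is \<open>muhat\<close>, SUKLS equals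
  \<open>D - A \<theta> + Z\<close> almost surely, and the density times \<open>Z\<close> is the divergence of the vector field
  \<open>p muhat\<close>. As \<open>muhat\<close> has bounded weak derivatives it grows at most linearly, so the integral of
  this divergence against a cutoff at radius \<open>n\<close> tends to \<open>0\<close>. But \<open>Z\<close> itself need not be integrable:
  only when one of its two parts is does Fatou's lemma show that it is integrable with mean zero,
  and \<open>D \<ge> 0\<close> supplies such a part unless both expectations in the theorem are infinite.\<close>

subsection \<open>Smooth functions\<close>

text \<open>The gradient in y of the log-density is \<open>\<nabla>h / h + \<theta>\<close>, which
  is why Z turns into a divergence. For the data at hand this is only formal: h and muhat are both
  merely weakly differentiable, so a product rule has to be proved, and h may vanish on a large set,
  where the quotient in SUKLS is 0 while the weak gradient of h is not known to be. The product rule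
  therefore mollifies h alone, leaves the weak derivative of muhat to act on a test function, and
  passes through functions of h whose slope at 0 is 0. Local bounds on muhat matter already here,
  since h and its gradient are only locally integrable. At infinity linear growth is harmless
  because A is finite everywhere: every exponential tilt of h is integrable, so the norm of Y has
  all exponential moments, and the gradient of the cutoff contributes a constant over n times a
  first moment. The same moments allow differentiation under the integral, which identifies the
  gradient of A with the mean and the Kullback-Leibler divergence with its Bregman form.\<close>

lemma partial_deriv_eq:
  assumes "(f has_derivative f') (at x)"
  shows "partial_deriv j f x = f' (axis j 1)"
  using assms unfolding partial_deriv_def by (simp add: frechet_derivative_at[symmetric])

lemma differentiable_on_UNIV_iff:
  "f differentiable_on UNIV \<longleftrightarrow> (\<forall>x. f differentiable at x)"
  by (auto simp: differentiable_on_def)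

lemma has_derivative_partial_deriv:
  fixes f :: "real^'d \<Rightarrow> real"
  assumes "f differentiable at x"
  shows "(f has_derivative (\<lambda>v. \<Sum>j\<in>UNIV. v $ j * partial_deriv j f x)) (at x)"
proof -
  have D: "(f has_derivative frechet_derivative f (at x)) (at x)"
    using assms by (simp add: frechet_derivative_works)
  interpret L: linear "frechet_derivative f (at x)"
    by (rule linear_frechet_derivative[OF assms])
  have "frechet_derivative f (at x) v = (\<Sum>j\<in>UNIV. v $ j * partial_deriv j f x)" for v
  proof -
    have "frechet_derivative f (at x) v = frechet_derivative f (at x) (\<Sum>j\<in>UNIV. v $ j *\<^sub>R axis j 1)"
      using basis_expansion[of v] by (simp add: scalar_mult_eq_scaleR)
    also have "\<dots> = (\<Sum>j\<in>UNIV. v $ j * partial_deriv j f x)"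
      by (simp add: L.sum L.scale partial_deriv_def)
    finally show ?thesis .
  qed
  then have "frechet_derivative f (at x) = (\<lambda>v. \<Sum>j\<in>UNIV. v $ j * partial_deriv j f x)" by auto
  with D show ?thesis by simp
qed

lemma Ck_Suc_imp_Ck: "Ck (Suc k) f \<Longrightarrow> Ck k f"
proof (induction k arbitrary: f)
  case 0
  then show ?case by (auto simp: differentiable_imp_continuous_on)
next
  case (Suc k)
  from Suc.prems have "f differentiable_on UNIV" and P: "\<And>j. Ck (Suc k) (partial_deriv j f)"
    by simp_all
  moreover have "Ck k (partial_deriv j f)" for j
    by (rule Suc.IH[OF P])
  ultimately show ?case by (simp only: Ck.simps) blast
qed

lemma Ck_const: "Ck k (\<lambda>x. c)"
proof (induction k arbitrary: c)
  case 0
  then show ?case by simp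
next
  case (Suc k)
  have "partial_deriv j (\<lambda>x::real^'a. c) = (\<lambda>x. 0)" for j
    by (rule ext) (simp add: partial_deriv_eq[OF has_derivative_const])
  with Suc show ?case by simp
qed

lemma partial_deriv_add:
  fixes f g :: "real^'d \<Rightarrow> real"
  assumes "f differentiable at x" "g differentiable at x"
  shows "partial_deriv j (\<lambda>x. f x + g x) x = partial_deriv j f x + partial_deriv j g x"
proof -
  have "((\<lambda>x. f x + g x) has_derivative (\<lambda>v. frechet_derivative f (at x) v + frechet_derivative g (at x) v)) (at x)"
    using assms by (intro has_derivative_add) (simp_all add: frechet_derivative_works)
  from partial_deriv_eq[OF this] show ?thesis by (simp add: partial_deriv_def)
qed

lemma partial_deriv_mult:
  fixes f g :: "real^'d \<Rightarrow> real"
  assumes "f differentiable at x" "g differentiable at x"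
  shows "partial_deriv j (\<lambda>x. f x * g x) x = f x * partial_deriv j g x + partial_deriv j f x * g x"
proof -
  have "((\<lambda>x. f x * g x) has_derivative
      (\<lambda>v. f x * frechet_derivative g (at x) v + frechet_derivative f (at x) v * g x)) (at x)"
    using assms by (intro has_derivative_mult) (simp_all add: frechet_derivative_works)
  from partial_deriv_eq[OF this] show ?thesis by (simp add: partial_deriv_def)
qed

lemma partial_deriv_comp:
  fixes q :: "real^'d \<Rightarrow> real"
  assumes "(\<phi> has_real_derivative c) (at (q x))" "q differentiable at x"
  shows "partial_deriv j (\<lambda>x. \<phi> (q x)) x = c * partial_deriv j q x"
proof -
  have "((\<lambda>x. \<phi> (q x)) has_derivative (\<lambda>v. c * frechet_derivative q (at x) v)) (at x)"
    using has_derivative_compose[of q "frechet_derivative q (at x)" x UNIV \<phi> "(*) c"] assms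
    by (simp add: frechet_derivative_works has_field_derivative_def)
  from partial_deriv_eq[OF this] show ?thesis by (simp add: partial_deriv_def)
qed

lemma Ck_add: "Ck k f \<Longrightarrow> Ck k g \<Longrightarrow> Ck k (\<lambda>x. f x + g x)"
proof (induction k arbitrary: f g)
  case 0
  then show ?case by (auto intro: continuous_on_add)
next
  case (Suc k)
  then have d: "\<And>x. f differentiable at x" "\<And>x. g differentiable at x"
    by (auto simp: differentiable_on_UNIV_iff)
  have "partial_deriv j (\<lambda>x. f x + g x) = (\<lambda>x. partial_deriv j f x + partial_deriv j g x)" for j
    using partial_deriv_add[OF d] by auto
  with Suc d show ?case by (auto simp: differentiable_on_UNIV_iff)
qed

lemma Ck_mult: "Ck k f \<Longrightarrow> Ck k g \<Longrightarrow> Ck k (\<lambda>x. f x * g x)"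
proof (induction k arbitrary: f g)
  case 0
  then show ?case by (auto intro: continuous_on_mult)
next
  case (Suc k)
  then have d: "\<And>x. f differentiable at x" "\<And>x. g differentiable at x"
    by (auto simp: differentiable_on_UNIV_iff)
  have "partial_deriv j (\<lambda>x. f x * g x) = (\<lambda>x. f x * partial_deriv j g x + partial_deriv j f x * g x)" for j
    using partial_deriv_mult[OF d] by auto
  with Suc d Ck_Suc_imp_Ck[OF Suc.prems(1)] Ck_Suc_imp_Ck[OF Suc.prems(2)] show ?case
    by (auto simp: differentiable_on_UNIV_iff intro!: Ck_add Suc.IH)
qed

text \<open>The outer function comes with its whole sequence of derivatives, so the chain rule only
  shifts the index \<open>n\<close>, which the induction on \<open>k\<close> leaves arbitrary. It
  serves \<open>exp\<close> with a constant sequence and \<open>flat\<close> with the iterates of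
  \<open>flat_deriv\<close>.\<close>

lemma Ck_comp:
  fixes \<phi> :: "nat \<Rightarrow> real \<Rightarrow> real" and q :: "real^'d \<Rightarrow> real"
  assumes \<phi>: "\<And>n t. (\<phi> n has_real_derivative \<phi> (Suc n) t) (at t)" and q: "\<And>k. Ck k q"
  shows "Ck k (\<lambda>x. \<phi> n (q x))"
proof (induction k arbitrary: n)
  case 0
  have "continuous_on UNIV (\<phi> n)"
    by (meson DERIV_isCont \<phi> continuous_at_imp_continuous_on)
  then show ?case
    using q[of 0] by (auto intro: continuous_on_compose2[of UNIV "\<phi> n"])
next
  case (Suc k)
  have d: "\<And>x. q differentiable at x"
    using q[of 1] by (auto simp: differentiable_on_UNIV_iff)
  have "(\<lambda>x. \<phi> n (q x)) differentiable at x" for x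
    using \<phi>[of n] d[of x] differentiable_compose[of "\<phi> n" q x UNIV]
    by (meson UNIV_I field_differentiable_def field_differentiable_imp_differentiable
        differentiable_at_withinI differentiable_chain_at o_def has_field_derivative_imp_has_derivative differentiable_def)
  moreover have "partial_deriv j (\<lambda>x. \<phi> n (q x)) = (\<lambda>x. \<phi> (Suc n) (q x) * partial_deriv j q x)" for j
    using partial_deriv_comp[OF \<phi> d] by auto
  moreover have "Ck k (partial_deriv j q)" for j
    using q[of "Suc k"] by simp
  ultimately show ?case
    by (auto simp: differentiable_on_UNIV_iff intro!: Ck_mult Suc.IH)
qed

lemma Ck_linear:
  assumes "bounded_linear f"
  shows "Ck k f"
proof -
  have D: "(f has_derivative f) (at x)" for x
    by (rule bounded_linear_imp_has_derivative[OF assms])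
  have P: "partial_deriv j f = (\<lambda>x. f (axis j 1))" for j
    by (rule ext) (simp add: partial_deriv_eq[OF D])
  show ?thesis
  proof (cases k)
    case 0
    then show ?thesis using assms by (simp add: linear_continuous_on)
  next
    case (Suc n)
    then show ?thesis
      using D by (auto simp: P differentiable_on_UNIV_iff differentiable_def Ck_const)
  qed
qed

lemma partial_deriv_inner_self: "partial_deriv j (\<lambda>x::real^'d. x \<bullet> x) x = 2 * x $ j"
proof -
  have "((\<lambda>x::real^'d. x \<bullet> x) has_derivative (\<lambda>v. x \<bullet> v + v \<bullet> x)) (at x)"
    by (auto intro!: derivative_eq_intros)
  from partial_deriv_eq[OF this] show ?thesis
    by (simp add: inner_axis inner_axis' inner_commute)
qed

lemma Ck_inner_self: "Ck k (\<lambda>x::real^'d. x \<bullet> x)"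
proof (cases k)
  case 0
  then show ?thesis by (auto intro!: continuous_intros)
next
  case (Suc n)
  have "Ck n (\<lambda>x::real^'d. 2 * x $ j)" for j
    by (rule Ck_linear) (auto intro!: bounded_linear_const_mult bounded_linear_vec_nth)
  moreover have "partial_deriv j (\<lambda>x::real^'d. x \<bullet> x) = (\<lambda>x. 2 * x $ j)" for j
    by (rule ext) (rule partial_deriv_inner_self)
  ultimately show ?thesis
    using Suc by (auto simp: differentiable_on_UNIV_iff)
qed

lemma partial_deriv_reflect:
  fixes f :: "real^'d \<Rightarrow> real"
  assumes "f differentiable at (c - x)"
  shows "partial_deriv j (\<lambda>x. f (c - x)) x = - partial_deriv j f (c - x)"
proof -
  have "((\<lambda>x. f (c - x)) has_derivative (\<lambda>v. frechet_derivative f (at (c - x)) (- v))) (at x)"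
    using assms
    by (intro has_derivative_compose[of "\<lambda>x. c - x" "\<lambda>v. - v" x UNIV f])
       (auto intro!: derivative_eq_intros simp: frechet_derivative_works)
  from partial_deriv_eq[OF this] show ?thesis
    by (simp add: partial_deriv_def linear_neg[OF linear_frechet_derivative[OF assms]])
qed

lemma Ck_reflect: "Ck k f \<Longrightarrow> Ck k (\<lambda>x. f (c - x))"
proof (induction k arbitrary: f)
  case 0
  then show ?case by (auto intro!: continuous_intros continuous_on_compose2[of UNIV f])
next
  case (Suc k)
  then have d: "\<And>x. f differentiable at x"
    by (auto simp: differentiable_on_UNIV_iff)
  have "(\<lambda>x. f (c - x)) differentiable at x" for x
    using d by (intro differentiable_compose[of f "\<lambda>x. c - x" x UNIV]) (auto intro!: derivative_intros)
  moreover have "partial_deriv j (\<lambda>x. f (c - x)) = (\<lambda>x. (- 1) * partial_deriv j f (c - x))" for j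
    using partial_deriv_reflect[OF d] by auto
  moreover have "Ck k (\<lambda>x. (- 1) * partial_deriv j f (c - x))" for j
    using Suc by (intro Ck_mult Ck_const) auto
  ultimately show ?case
    by (simp add: differentiable_on_UNIV_iff)
qed

section \<open>Test functions: supports, bounds and closure properties\<close>

lemma test_function_Ck: "test_function \<psi> \<Longrightarrow> Ck k \<psi>"
  by (simp add: test_function_def)

lemma Ck_differentiable: "Ck (Suc k) f \<Longrightarrow> f differentiable at x"
  by (simp add: differentiable_on_UNIV_iff)

lemma test_function_differentiable: "test_function \<psi> \<Longrightarrow> \<psi> differentiable at x"
  using Ck_differentiable test_function_Ck by blast

lemma test_function_continuous: "test_function \<psi> \<Longrightarrow> continuous_on UNIV \<psi>"
  using test_function_Ck[of \<psi> 0] by simp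

lemma test_functionI:
  assumes "\<And>k. Ck k \<psi>" "\<And>x. \<psi> x \<noteq> 0 \<Longrightarrow> norm x \<le> r"
  shows "test_function \<psi>"
proof -
  have "{x. \<psi> x \<noteq> 0} \<subseteq> cball 0 r"
    using assms(2) by auto
  then have "bounded {x. \<psi> x \<noteq> 0}"
    using bounded_subset bounded_cball by blast
  then show ?thesis
    using assms(1) by (simp add: test_function_def)
qed

lemma test_function_support:
  assumes "test_function \<psi>"
  obtains r where "r > 0" "\<And>x. norm x > r \<Longrightarrow> \<psi> x = 0"
proof -
  have "bounded {x. \<psi> x \<noteq> 0}"
    using assms bounded_subset[OF compact_imp_bounded closure_subset] by (auto simp: test_function_def)
  then obtain r where "r > 0" "\<And>x. \<psi> x \<noteq> 0 \<Longrightarrow> norm x \<le> r"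
    by (auto simp: bounded_pos)
  then show ?thesis using that[of r] by force
qed

lemma test_function_mult:
  assumes "test_function \<psi>" "\<And>k. Ck k f"
  shows "test_function (\<lambda>x. \<psi> x * f x)"
proof -
  obtain r where "\<And>x. norm x > r \<Longrightarrow> \<psi> x = 0" using test_function_support[OF assms(1)] by blast
  then show ?thesis
    using assms by (intro test_functionI[of _ r]) (auto intro!: Ck_mult simp: test_function_Ck not_less[symmetric])
qed

lemma partial_deriv_eq_0_outside:
  fixes \<psi> :: "real^'d \<Rightarrow> real"
  assumes "\<And>x. norm x > r \<Longrightarrow> \<psi> x = 0" and "norm x > r"
  shows "partial_deriv j \<psi> x = 0"
proof -
  have "((\<lambda>x. 0) has_derivative (\<lambda>v. 0)) (at x)" by simp
  moreover have "open {y::real^'d. norm y > r}" by (intro open_Collect_less continuous_intros)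
  ultimately have "(\<psi> has_derivative (\<lambda>v. 0)) (at x)"
    by (rule has_derivative_transform_within_open) (use assms in auto)
  from partial_deriv_eq[OF this] show ?thesis .
qed

lemma test_function_partial:
  assumes "test_function \<psi>"
  shows "test_function (partial_deriv j \<psi>)"
proof -
  obtain r where r: "\<And>x. norm x > r \<Longrightarrow> \<psi> x = 0" using test_function_support[OF assms(1)] by blast
  have "partial_deriv j \<psi> x = 0" if "norm x > r" for x
    by (rule partial_deriv_eq_0_outside[OF r that])
  moreover have "Ck k (partial_deriv j \<psi>)" for k
    using test_function_Ck[OF assms, of "Suc k"] by simp
  ultimately show ?thesis
    by (intro test_functionI[of _ r]) (auto simp: not_less[symmetric])
qed

lemma test_function_reflect:
  assumes "test_function \<psi>"
  shows "test_function (\<lambda>x. \<psi> (c - x))"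
proof -
  obtain r where r: "\<And>x. norm x > r \<Longrightarrow> \<psi> x = 0" using test_function_support[OF assms(1)] by blast
  have "\<psi> (c - x) \<noteq> 0 \<Longrightarrow> norm x \<le> r + norm c" for x
    using r[of "c - x"] norm_triangle_ineq4[of c "c - x"] by (force simp: not_less[symmetric])
  then show ?thesis
    using assms by (intro test_functionI[of _ "r + norm c"]) (auto intro!: Ck_reflect simp: test_function_Ck)
qed

lemma test_function_bounded:
  assumes "test_function \<psi>"
  obtains C where "C > 0" "\<And>x. \<bar>\<psi> x\<bar> \<le> C"
proof -
  obtain r where r: "\<And>x. norm x > r \<Longrightarrow> \<psi> x = 0" using test_function_support[OF assms(1)] by blast
  have "compact (\<psi> ` cball 0 r)"
    using test_function_continuous[OF assms] by (intro compact_continuous_image) (auto intro: continuous_on_subset)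
  then obtain C where C: "C > 0" "\<And>x. norm x \<le> r \<Longrightarrow> \<bar>\<psi> x\<bar> \<le> C"
    using compact_imp_bounded[of "\<psi> ` cball 0 r"] unfolding bounded_pos by force
  have "\<bar>\<psi> x\<bar> \<le> C" for x
    using C(1) C(2)[of x] r[of x] by (cases "norm x \<le> r") auto
  with C(1) that show ?thesis by blast
qed

subsection \<open>Smooth cutoffs\<close>

text \<open>Derivatives of \<open>t \<mapsto> exp (-1/t)\<close> stay in this class, which makes them explicit.\<close>

definition flat :: "real poly \<Rightarrow> real \<Rightarrow> real" where
  "flat P t = (if t > 0 then poly P (1/t) * exp (- (1/t)) else 0)"

text \<open>In the variable \<open>s = 1/t\<close>, the derivative of
  \<open>P(s) * exp (- s)\<close> with respect to \<open>t\<close> is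
  \<open>s^2 * (P(s) - P'(s)) * exp (- s)\<close>, again a polynomial in \<open>s\<close> times the
  same exponential.\<close>

definition flat_deriv :: "real poly \<Rightarrow> real poly" where
  "flat_deriv P = [:0, 0, 1:] * (P - pderiv P)"

text \<open>The factor \<open>s ^ k\<close> is there for the induction on the polynomial: peeling
  off a coefficient leaves one more factor \<open>s\<close>, which the power absorbs.\<close>

lemma poly_exp_tendsto_0: "((\<lambda>s::real. s ^ k * poly P s * exp (- s)) \<longlongrightarrow> 0) at_top"
proof (induction P arbitrary: k)
  case 0
  then show ?case by simp
next
  case (pCons a P)
  have "((\<lambda>s::real. a * (s ^ k / exp s) + s ^ Suc k * poly P s * exp (- s)) \<longlongrightarrow> a * 0 + 0) at_top"
    by (intro tendsto_intros pCons.IH tendsto_power_div_exp_0)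
  then show ?case
    by (simp add: algebra_simps exp_minus divide_inverse)
qed

lemma flat_has_derivative: "(flat P has_real_derivative flat (flat_deriv P) t) (at t)"
proof -
  consider "t > 0" | "t < 0" | "t = 0" by linarith
  then show ?thesis
  proof cases
    case 1
    have "((\<lambda>t. poly P (1/t) * exp (- (1/t))) has_real_derivative flat (flat_deriv P) t) (at t)"
      using 1 by (auto intro!: derivative_eq_intros poly_DERIV[THEN DERIV_chain2]
          simp: flat_def flat_deriv_def divide_simps algebra_simps power2_eq_square)
    then show ?thesis
      by (rule has_field_derivative_transform_within_open[where S="{0<..}"])
         (use 1 in \<open>auto simp: flat_def\<close>)
  next
    case 2
    have "((\<lambda>t. 0) has_real_derivative flat (flat_deriv P) t) (at t)"
      using 2 by (simp add: flat_def)
    then show ?thesis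
      by (rule has_field_derivative_transform_within_open[where S="{..<0}"])
         (use 2 in \<open>auto simp: flat_def\<close>)
  next
    case 3
    \<comment> \<open>At 0 the difference quotient is identically 0 on the left; on the right,
      \<open>y = 1/s\<close> turns it into \<open>s * poly P s * exp (- s)\<close>, the case
      \<open>k = 1\<close> of the limit above.\<close>
    have "((\<lambda>y. flat P y / y) \<longlongrightarrow> 0) (at_left 0)"
      by (rule tendsto_eventually) (auto simp: flat_def eventually_at_filter)
    moreover have "((\<lambda>y. flat P y / y) \<longlongrightarrow> 0) (at_right 0)"
      unfolding filterlim_at_right_to_top
    proof (rule Lim_transform_eventually[OF poly_exp_tendsto_0[of 1 P]])
      show "\<forall>\<^sub>F x in at_top. x ^ 1 * poly P x * exp (- x) = flat P (inverse x) / inverse x"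
        using eventually_gt_at_top[of 0] by eventually_elim (auto simp: flat_def field_simps)
    qed
    ultimately have "((\<lambda>y. flat P y / y) \<longlongrightarrow> 0) (at 0)"
      by (simp add: filterlim_split_at)
    then show ?thesis
      using 3 by (simp add: has_field_derivative_iff flat_def)
  qed
qed

text \<open>The squared norm \<open>x \<bullet> x\<close> is a polynomial, so smoothness at the
  origin does not suffer as it might with \<open>norm x\<close>.\<close>

definition bump :: "real \<Rightarrow> real^'d \<Rightarrow> real" where
  "bump r x = flat 1 (r\<^sup>2 - x \<bullet> x)"

lemma Ck_flat_comp:
  assumes "\<And>k. Ck k q"
  shows "Ck k (\<lambda>x. flat P (q x))"
  using Ck_comp[of "\<lambda>n. flat ((flat_deriv ^^ n) P)" q k 0] assms
  by (simp add: flat_has_derivative)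

lemma Ck_paraboloid: "Ck k (\<lambda>x::real^'d. c - x \<bullet> x)"
proof -
  have "Ck k (\<lambda>x::real^'d. c + (- 1) * (x \<bullet> x))"
    by (intro Ck_add Ck_mult Ck_const Ck_inner_self)
  then show ?thesis by simp
qed

lemma bump_nonneg: "0 \<le> bump r x"
  by (simp add: bump_def flat_def)

lemma bump_nonzero_iff:
  fixes x :: "real^'d"
  assumes "r > 0"
  shows "bump r x \<noteq> 0 \<longleftrightarrow> norm x < r"
  using assms abs_less_iff real_sqrt_less_iff power_less_imp_less_base[of "norm x" 2 r] power_strict_mono[of "norm x" r 2]
  by (auto simp: bump_def flat_def power2_norm_eq_inner)

lemma test_function_bump:
  assumes "r > 0"
  shows "test_function (bump r)"
proof (rule test_functionI[of _ r])
  show "Ck k (bump r)" for k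
    unfolding bump_def[abs_def] by (intro Ck_flat_comp Ck_paraboloid)
qed (simp add: bump_nonzero_iff[OF assms])

subsection \<open>Differentiation under the integral and convolution\<close>

text \<open>Dominated convergence is applied to the remainder quotient itself, which yields the full
  Frechet derivative and not only directional ones. The bound \<open>G\<close> serves twice, through
  the mean value inequality for the increment and directly for the linear term; hence the dominating
  function \<open>2 * G\<close>.\<close>

lemma has_derivative_integral:
  fixes F :: "'a::real_normed_vector \<Rightarrow> 'b \<Rightarrow> real"
  assumes r: "r > 0"
    and der: "\<And>x y. x \<in> ball x0 r \<Longrightarrow> y \<in> space M \<Longrightarrow> ((\<lambda>x. F x y) has_derivative F' x y) (at x)"
    and int: "\<And>x. x \<in> ball x0 r \<Longrightarrow> integrable M (F x)"
    and meas: "\<And>v. (\<lambda>y. F' x0 y v) \<in> borel_measurable M"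
    and bound: "\<And>x y v. x \<in> ball x0 r \<Longrightarrow> y \<in> space M \<Longrightarrow> \<bar>F' x y v\<bar> \<le> G y * norm v"
    and G: "integrable M G" "\<And>y. y \<in> space M \<Longrightarrow> 0 \<le> G y"
  shows "((\<lambda>x. LINT y|M. F x y) has_derivative (\<lambda>v. LINT y|M. F' x0 y v)) (at x0)"
proof -
  have x0: "x0 \<in> ball x0 r" using r by simp
  have intF': "integrable M (\<lambda>y. F' x0 y v)" for v
    by (rule Bochner_Integration.integrable_bound[OF integrable_mult_left[OF G(1), of "norm v"] meas])
       (use bound[OF x0] in \<open>auto intro!: AE_I2 intro: order_trans[OF _ abs_ge_self]\<close>)
  have lin: "bounded_linear (F' x0 y)" if "y \<in> space M" for y
    using der[OF x0 that] by (rule has_derivative_bounded_linear)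
  have bl: "bounded_linear (\<lambda>v. LINT y|M. F' x0 y v)"
  proof (rule bounded_linear_intro)
    fix v w c
    show "(LINT y|M. F' x0 y (v + w)) = (LINT y|M. F' x0 y v) + (LINT y|M. F' x0 y w)"
      unfolding Bochner_Integration.integral_add[OF intF' intF', symmetric]
      by (rule Bochner_Integration.integral_cong) (auto simp: linear_add[OF bounded_linear.linear[OF lin]])
    show "(LINT y|M. F' x0 y (c *\<^sub>R v)) = c *\<^sub>R (LINT y|M. F' x0 y v)"
      unfolding integral_scaleR_right[symmetric]
      by (rule Bochner_Integration.integral_cong) (auto simp: linear_scale[OF bounded_linear.linear[OF lin]])
    have "norm (LINT y|M. F' x0 y v) \<le> (LINT y|M. G y * norm v)"
      by (rule order_trans[OF integral_norm_bound Bochner_Integration.integral_mono])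
         (use intF' bound[OF x0] G in auto)
    then show "norm (LINT y|M. F' x0 y v) \<le> norm v * (LINT y|M. G y)"
      by (simp add: mult.commute)
  qed
  have incr: "\<bar>F (x0 + v) y - F x0 y\<bar> \<le> G y * norm v" if "norm v < r" "y \<in> space M" for v y
  proof -
    have "norm (F (x0 + v) y - F x0 y) \<le> G y * norm (x0 + v - x0)"
    proof (rule differentiable_bound[of "ball x0 r" "\<lambda>x. F x y" "\<lambda>x. F' x y"])
      show "onorm (F' x y) \<le> G y" if "x \<in> ball x0 r" for x
        using bound[OF that \<open>y \<in> space M\<close>] by (intro onorm_bound G) (auto simp: \<open>y \<in> space M\<close>)
    qed (use der that r in \<open>auto simp: dist_norm intro: has_derivative_at_withinI\<close>)
    then show ?thesis by simp
  qed
  let ?Q = "\<lambda>v y. (F (x0 + v) y - F x0 y - F' x0 y v) / norm v"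
  have lim: "((\<lambda>v. LINT y|M. ?Q v y) \<longlongrightarrow> 0) (at 0)"
    unfolding tendsto_at_iff_sequentially comp_def
  proof (intro allI impI)
    fix X :: "nat \<Rightarrow> 'a"
    assume X: "\<forall>i. X i \<in> UNIV - {0}" "X \<longlonglongrightarrow> 0"
    then have "\<exists>N. \<forall>n\<ge>N. norm (X n) < r"
      using r by (auto simp: LIMSEQ_iff)
    then obtain N where N: "\<And>n. n \<ge> N \<Longrightarrow> norm (X n) < r"
      by blast
    \<comment> \<open>The quotient is dominated only for increments shorter than \<open>r\<close>,
      so the first \<open>N\<close> terms are dropped here and restored by
      \<open>LIMSEQ_offset\<close>.\<close>
    have "(\<lambda>n. LINT y|M. ?Q (X (n + N)) y) \<longlonglongrightarrow> (LINT y|M. 0)"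
    proof (rule integral_dominated_convergence[where w="\<lambda>y. 2 * G y"])
      show "(\<lambda>y. ?Q (X (n + N)) y) \<in> borel_measurable M" for n
        using int[of "x0 + X (n + N)"] int[OF x0] N[of "n + N"] meas
        by (intro borel_measurable_divide borel_measurable_diff borel_measurable_const)
           (auto simp: dist_norm)
      show "AE y in M. (\<lambda>n. ?Q (X (n + N)) y) \<longlonglongrightarrow> 0"
      proof (rule AE_I2)
        fix y assume y: "y \<in> space M"
        have "((\<lambda>v. norm (F (x0 + v) y - F x0 y - F' x0 y v) / norm v) \<longlongrightarrow> 0) (at 0)"
          using der[OF x0 y] by (simp add: has_derivative_at)
        from this[unfolded tendsto_at_iff_sequentially comp_def, rule_format, OF _ X(2)]
        have "(\<lambda>n. norm (F (x0 + X n) y - F x0 y - F' x0 y (X n)) / norm (X n)) \<longlonglongrightarrow> 0"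
          using X(1) by blast
        then have "(\<lambda>n. norm (?Q (X n) y)) \<longlonglongrightarrow> 0" by simp
        then show "(\<lambda>n. ?Q (X (n + N)) y) \<longlonglongrightarrow> 0"
          by (rule LIMSEQ_ignore_initial_segment[OF tendsto_norm_zero_cancel])
      qed
      show "AE y in M. norm (?Q (X (n + N)) y) \<le> 2 * G y" for n
      proof (rule AE_I2)
        fix y assume y: "y \<in> space M"
        have "\<bar>F (x0 + X (n + N)) y - F x0 y - F' x0 y (X (n + N))\<bar> \<le> 2 * G y * norm (X (n + N))"
          using incr[of "X (n + N)" y] bound[OF x0 y, of "X (n + N)"] N[of "n + N"] y by auto
        then show "norm (?Q (X (n + N)) y) \<le> 2 * G y"
          using X(1) by (auto simp: divide_simps)
      qed
    qed (use G in auto)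
    then show "(\<lambda>n. LINT y|M. ?Q (X n) y) \<longlonglongrightarrow> 0"
      using LIMSEQ_offset[where f="\<lambda>n. LINT y|M. ?Q (X n) y" and k=N and a=0] by simp
  qed
  have ev: "\<forall>\<^sub>F v in at 0. norm ((LINT y|M. F (x0 + v) y) - (LINT y|M. F x0 y) - (LINT y|M. F' x0 y v)) / norm v
      = norm (LINT y|M. ?Q v y)"
  proof -
    have "\<forall>\<^sub>F v in at (0::'a). norm v < r"
      using r by (auto simp: eventually_at dist_norm)
    then show ?thesis
    proof eventually_elim
      case (elim v)
      then have "integrable M (F (x0 + v))" by (intro int) (simp add: dist_norm)
      with int[OF x0] intF' show ?case by simp
    qed
  qed
  have "((\<lambda>v. norm ((LINT y|M. F (x0 + v) y) - (LINT y|M. F x0 y) - (LINT y|M. F' x0 y v)) / norm v) \<longlongrightarrow> 0) (at 0)"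
    by (rule iffD2[OF tendsto_cong[OF ev] tendsto_norm_zero[OF lim]])
  with bl show ?thesis by (simp add: has_derivative_at)
qed

section \<open>Locally integrable functions and their products with bounded weights of compact
  support\<close>

lemma locally_integrable_measurable:
  assumes "locally_integrable f"
  shows "f \<in> borel_measurable borel"
proof (rule borel_measurable_LIMSEQ_real)
  fix i :: nat
  have "set_integrable lborel (cball 0 (real i)) f"
    using assms by (simp add: locally_integrable_def)
  then show "(\<lambda>x. indicator (cball 0 (real i)) x * f x) \<in> borel_measurable borel"
    by (auto simp: set_integrable_def)
next
  fix x :: "real^'a"
  obtain n :: nat where n: "norm x \<le> n" using real_arch_simple by blast
  have "indicator (cball 0 (real i)) x * f x = f x" if "i \<ge> n" for i
    using n that by simp
  then have "\<forall>\<^sub>F i in sequentially. indicator (cball 0 (real i)) x * f x = f x"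
    by (auto simp: eventually_sequentially)
  then show "(\<lambda>i. indicator (cball 0 (real i)) x * f x) \<longlonglongrightarrow> f x"
    by (rule tendsto_eventually)
qed

text \<open>The weight is bounded only almost everywhere because it will be a test function times a
  component of \<open>muhat\<close> or of its Jacobian, whose bounds hold off a null set.\<close>

lemma locally_integrable_mult:
  assumes "locally_integrable f" "g \<in> borel_measurable borel"
    and bd: "AE x in lborel. \<bar>g x\<bar> \<le> C * indicator (cball 0 r) x"
  shows "integrable lborel (\<lambda>x. f x * g x)"
proof (rule Bochner_Integration.integrable_bound)
  have "set_integrable lborel (cball 0 r) f"
    using assms(1) by (simp add: locally_integrable_def)
  then show "integrable lborel (\<lambda>x. C * (indicator (cball 0 r) x * f x))"
    by (simp add: set_integrable_def)
  show "(\<lambda>x. f x * g x) \<in> borel_measurable lborel"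
    using assms(2) locally_integrable_measurable[OF assms(1)] by simp
  show "AE x in lborel. norm (f x * g x) \<le> norm (C * (indicator (cball 0 r) x * f x))"
    using bd
  proof eventually_elim
    case (elim x)
    have "\<bar>g x\<bar> * \<bar>f x\<bar> \<le> C * indicator (cball 0 r) x * \<bar>f x\<bar>"
      using elim by (intro mult_right_mono) auto
    also have "\<dots> \<le> \<bar>C * indicator (cball 0 r) x * \<bar>f x\<bar>\<bar>" by simp
    finally show ?case by (simp add: abs_mult mult_ac)
  qed
qed

lemma locally_integrable_mult_continuous:
  assumes "locally_integrable f" "continuous_on UNIV g" "\<And>x. norm x > r \<Longrightarrow> g x = 0"
  shows "integrable lborel (\<lambda>x. f x * g x)"
proof -
  have "compact (g ` cball 0 r)"
    using assms(2) by (intro compact_continuous_image) (auto intro: continuous_on_subset)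
  then obtain C where "\<And>x. norm x \<le> r \<Longrightarrow> \<bar>g x\<bar> \<le> C"
    using compact_imp_bounded[of "g ` cball 0 r"] unfolding bounded_pos by force
  with assms show ?thesis
    by (intro locally_integrable_mult[where r=r and C=C])
       (auto intro: borel_measurable_continuous_onI simp: indicator_def)
qed

lemma locally_integrable_mult_test:
  assumes "locally_integrable f" "test_function \<psi>"
  shows "integrable lborel (\<lambda>x. f x * \<psi> x)"
  using test_function_support[OF assms(2)] locally_integrable_mult_continuous[OF assms(1) test_function_continuous[OF assms(2)]]
  by metis

lemma integrable_imp_locally_integrable:
  "integrable lborel f \<Longrightarrow> locally_integrable f"
  unfolding locally_integrable_def set_integrable_def
  by (intro allI impI integrable_mult_indicator) (auto simp: compact_imp_closed borel_closed)

section \<open>Convolution with a test function\<close>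

definition conv :: "(real^'d \<Rightarrow> real) \<Rightarrow> (real^'d \<Rightarrow> real) \<Rightarrow> real^'d \<Rightarrow> real" where
  "conv f \<psi> x = (LINT y|lborel. f y * \<psi> (x - y))"

text \<open>All differentiation falls on the smooth kernel. For points near \<open>x\<close> the
  differentiated kernels are uniformly bounded and live on one ball, so a multiple of the absolute
  value of \<open>f\<close> on that ball dominates them all.\<close>

lemma conv_has_derivative:
  fixes f :: "real^'d \<Rightarrow> real"
  assumes f: "locally_integrable f" and \<psi>: "test_function \<psi>"
  shows "(conv f \<psi> has_derivative (\<lambda>v. \<Sum>j\<in>UNIV. v $ j * conv f (partial_deriv j \<psi>) x)) (at x)"
proof -
  have p: "test_function (partial_deriv j \<psi>)" for j by (rule test_function_partial[OF \<psi>])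
  have "\<exists>C. C > 0 \<and> (\<forall>x. \<bar>partial_deriv j \<psi> x\<bar> \<le> C)" for j
    using test_function_bounded[OF p] by metis
  then obtain C where C: "\<And>j. C j > 0" "\<And>j x. \<bar>partial_deriv j \<psi> x\<bar> \<le> C j" by metis
  obtain r where r: "r > 0" "\<And>x. norm x > r \<Longrightarrow> \<psi> x = 0" using test_function_support[OF \<psi>] by blast
  \<comment> \<open>For \<open>z\<close> within distance 1 of \<open>x\<close>, the kernel
    \<open>\<psi> (z - y)\<close> and its derivatives vanish as soon as
    \<open>norm y > R\<close>.\<close>
  define R where "R = r + norm x + 1"
  define S where "S = (\<Sum>j\<in>UNIV. C j)"
  have S: "S \<ge> 0" unfolding S_def by (intro sum_nonneg less_imp_le C)
  have m[measurable]: "f \<in> borel_measurable borel" "(\<lambda>y. partial_deriv j \<psi> (x - y)) \<in> borel_measurable borel" for j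
    by (rule locally_integrable_measurable[OF f])
       (rule borel_measurable_continuous_onI, rule test_function_continuous[OF test_function_reflect[OF p]])
  have cint: "integrable lborel (\<lambda>y. f y * \<phi> (x - y))" if "test_function \<phi>" for \<phi> x
    by (rule locally_integrable_mult_test[OF f test_function_reflect[OF that]])
  have "((\<lambda>x. LINT y|lborel. f y * \<psi> (x - y)) has_derivative
      (\<lambda>v. LINT y|lborel. f y * (\<Sum>j\<in>UNIV. v $ j * partial_deriv j \<psi> (x - y)))) (at x)"
  proof (rule has_derivative_integral[where r=1 and G="\<lambda>y. \<bar>f y\<bar> * (S * indicator (cball 0 R) y)"
        and F'="\<lambda>x y v. f y * (\<Sum>j\<in>UNIV. v $ j * partial_deriv j \<psi> (x - y))"])
    fix z y :: "real^'d" assume z: "z \<in> ball x 1"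
    show "((\<lambda>x. f y * \<psi> (x - y)) has_derivative (\<lambda>v. f y * (\<Sum>j\<in>UNIV. v $ j * partial_deriv j \<psi> (z - y)))) (at z)"
      by (intro has_derivative_mult_right
          has_derivative_compose[of "\<lambda>x. x - y" "\<lambda>v. v" z UNIV \<psi>, OF _ has_derivative_partial_deriv])
         (auto intro!: derivative_eq_intros test_function_differentiable[OF \<psi>])
    fix v
    show "\<bar>f y * (\<Sum>j\<in>UNIV. v $ j * partial_deriv j \<psi> (z - y))\<bar> \<le> \<bar>f y\<bar> * (S * indicator (cball 0 R) y) * norm v"
    proof (cases "norm y \<le> R")
      case True
      have "\<bar>\<Sum>j\<in>UNIV. v $ j * partial_deriv j \<psi> (z - y)\<bar> \<le> (\<Sum>j\<in>UNIV. norm v * C j)"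
        by (rule order_trans[OF sum_abs]) (auto simp: abs_mult intro!: sum_mono mult_mono C component_le_norm_cart)
      also have "\<dots> = S * norm v" unfolding S_def mult.commute[of "sum C UNIV"] sum_distrib_left ..
      finally show ?thesis using True by (simp add: abs_mult mult.assoc mult_left_mono)
    next
      case False
      have "norm y \<le> norm (z - y) + norm (z - x) + norm x"
        by norm
      then have "norm (z - y) > r"
        using False z by (simp add: R_def dist_norm norm_minus_commute)
      then have "partial_deriv j \<psi> (z - y) = 0" for j
        using partial_deriv_eq_0_outside[of r \<psi>] r by blast
      then show ?thesis using S by simp
    qed
  next
    show "integrable lborel (\<lambda>y. \<bar>f y\<bar> * (S * indicator (cball 0 R) y))"
    proof -
      have "(\<lambda>y. S * indicat_real (cball 0 R) y) \<in> borel_measurable borel"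
        by (intro borel_measurable_times borel_measurable_const borel_measurable_indicator) simp
      from integrable_abs[OF locally_integrable_mult[OF f this, of S R]] show ?thesis
        using S by (simp add: abs_mult)
    qed
  qed (use cint[OF \<psi>] S in auto)
  moreover have "(LINT y|lborel. f y * (\<Sum>j\<in>UNIV. v $ j * partial_deriv j \<psi> (x - y)))
      = (\<Sum>j\<in>UNIV. v $ j * conv f (partial_deriv j \<psi>) x)" for v
  proof -
    have "(LINT y|lborel. f y * (\<Sum>j\<in>UNIV. v $ j * partial_deriv j \<psi> (x - y)))
        = (LINT y|lborel. (\<Sum>j\<in>UNIV. v $ j * (f y * partial_deriv j \<psi> (x - y))))"
      by (simp add: sum_distrib_left mult_ac)
    also have "\<dots> = (\<Sum>j\<in>UNIV. v $ j * (LINT y|lborel. f y * partial_deriv j \<psi> (x - y)))"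
      using cint[OF p] by (subst Bochner_Integration.integral_sum) auto
    finally show ?thesis by (simp add: conv_def)
  qed
  ultimately show ?thesis by (simp add: conv_def[abs_def])
qed

lemma partial_deriv_conv:
  assumes "locally_integrable f" "test_function \<psi>"
  shows "partial_deriv j (conv f \<psi>) x = conv f (partial_deriv j \<psi>) x"
  using partial_deriv_eq[OF conv_has_derivative[OF assms], of j x]
  by (simp add: axis_def if_distrib if_distribR cong: if_cong)

lemma Ck_conv:
  assumes f: "locally_integrable f" and "test_function \<psi>"
  shows "Ck k (conv f \<psi>)"
  using assms(2)
proof (induction k arbitrary: \<psi>)
  case 0
  have "conv f \<psi> differentiable at x" for x
    using conv_has_derivative[OF f 0] by (auto simp: differentiable_def)
  then show ?case
    by (simp add: differentiable_imp_continuous_on differentiable_on_UNIV_iff)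
next
  case (Suc k)
  have "conv f \<psi> differentiable at x" for x
    using conv_has_derivative[OF f Suc.prems] by (auto simp: differentiable_def)
  moreover have "partial_deriv j (conv f \<psi>) = conv f (partial_deriv j \<psi>)" for j
    using partial_deriv_conv[OF f Suc.prems] by auto
  ultimately show ?case
    using Suc by (simp add: differentiable_on_UNIV_iff test_function_partial)
qed

text \<open>The derivative sits on the kernel and moves to \<open>f\<close> by testing with
  \<open>y \<mapsto> \<psi> (x - y)\<close>. The sign produced by the reflection cancels the sign in
  the definition of the weak derivative.\<close>

lemma partial_deriv_conv_weak:
  assumes "has_weak_partial_deriv j f g" "test_function \<psi>"
  shows "partial_deriv j (conv f \<psi>) x = conv g \<psi> x"
proof -
  have t: "test_function (\<lambda>y. \<psi> (x - y))" by (rule test_function_reflect[OF assms(2)])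
  have "conv f (partial_deriv j \<psi>) x = - (LINT y|lborel. f y * partial_deriv j (\<lambda>y. \<psi> (x - y)) y)"
    by (simp add: conv_def partial_deriv_reflect test_function_differentiable[OF assms(2)])
  also have "\<dots> = conv g \<psi> x"
    using assms(1) t by (simp add: has_weak_partial_deriv_def conv_def)
  finally show ?thesis
    using assms by (simp add: partial_deriv_conv has_weak_partial_deriv_def)
qed

subsection \<open>Continuity of translation in \<open>L\<^sup>1\<close>\<close>

lemma lborel_integrable_translation:
  fixes f :: "'a::euclidean_space \<Rightarrow> real"
  assumes "integrable lborel f"
  shows "integrable lborel (\<lambda>x. f (x + z))"
proof -
  have "integrable (distr lborel borel ((+) z)) f"
    using assms by (simp add: lborel_distr_plus)
  then show ?thesis
    by (subst (asm) integrable_distr_eq) (use assms in \<open>auto simp: add.commute\<close>)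
qed

lemma lborel_integral_translation:
  fixes f :: "'a::euclidean_space \<Rightarrow> real"
  assumes [measurable]: "f \<in> borel_measurable borel"
  shows "(LINT x|lborel. f (x + z)) = (LINT x|lborel. f x)"
proof -
  have "(LINT x|lborel. f x) = (LINT x|distr lborel borel ((+) z). f x)"
    by (simp add: lborel_distr_plus)
  also have "\<dots> = (LINT x|lborel. f (z + x))"
    by (rule integral_distr) auto
  finally show ?thesis by (simp add: add.commute)
qed

definition L1_modulus :: "('a::euclidean_space \<Rightarrow> real) \<Rightarrow> 'a \<Rightarrow> real" where
  "L1_modulus F z = (LINT x|lborel. \<bar>F (x + z) - F x\<bar>)"

lemma L1_modulus_nonneg: "0 \<le> L1_modulus F z"
  by (simp add: L1_modulus_def)

lemma L1_modulus_integrable: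
  fixes F :: "'a::euclidean_space \<Rightarrow> real"
  shows "integrable lborel F \<Longrightarrow> integrable lborel (\<lambda>x. \<bar>F (x + z) - F x\<bar>)"
  by (rule integrable_abs[OF Bochner_Integration.integrable_diff[OF lborel_integrable_translation]])

text \<open>Insert \<open>G\<close> at both points. The two errors have equal integrals by
  translation invariance, hence the factor 2. It follows that the functions whose modulus vanishes
  at 0 are closed under \<open>L^1\<close> limits.\<close>

lemma L1_modulus_approx:
  fixes F G :: "'a::euclidean_space \<Rightarrow> real"
  assumes F: "integrable lborel F" and G: "integrable lborel G"
  shows "L1_modulus F z \<le> L1_modulus G z + 2 * (LINT x|lborel. \<bar>F x - G x\<bar>)"
proof -
  have FG: "integrable lborel (\<lambda>x. \<bar>F x - G x\<bar>)" using assms by auto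
  have "L1_modulus F z \<le> (LINT x|lborel. \<bar>F (x + z) - G (x + z)\<bar> + \<bar>G (x + z) - G x\<bar> + \<bar>F x - G x\<bar>)"
    unfolding L1_modulus_def
    by (intro Bochner_Integration.integral_mono L1_modulus_integrable F Bochner_Integration.integrable_add G FG
         lborel_integrable_translation[OF FG]) auto
  also have "\<dots> = (LINT x|lborel. \<bar>F (x + z) - G (x + z)\<bar>) + L1_modulus G z + (LINT x|lborel. \<bar>F x - G x\<bar>)"
    unfolding L1_modulus_def
    using L1_modulus_integrable[OF G, of z] FG lborel_integrable_translation[OF FG, of z] by simp
  also have "(LINT x|lborel. \<bar>F (x + z) - G (x + z)\<bar>) = (LINT x|lborel. \<bar>F x - G x\<bar>)"
    by (rule lborel_integral_translation[of "\<lambda>x. \<bar>F x - G x\<bar>"])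
       (use F G in \<open>auto dest!: borel_measurable_integrable\<close>)
  finally show ?thesis by simp
qed

lemma L1_modulus_tendsto_limit:
  fixes F :: "'a::euclidean_space \<Rightarrow> real"
  assumes F: "integrable lborel F"
    and approx: "\<And>e. e > 0 \<Longrightarrow> \<exists>G. integrable lborel G \<and> (L1_modulus G \<longlongrightarrow> 0) (at 0) \<and> (LINT x|lborel. \<bar>F x - G x\<bar>) < e"
  shows "(L1_modulus F \<longlongrightarrow> 0) (at 0)"
proof (rule tendstoI)
  fix e :: real assume "e > 0"
  then obtain G where G: "integrable lborel G" "(L1_modulus G \<longlongrightarrow> 0) (at 0)" "(LINT x|lborel. \<bar>F x - G x\<bar>) < e / 4"
    using approx[of "e / 4"] by auto
  have "\<forall>\<^sub>F z in at 0. dist (L1_modulus G z) 0 < e / 2"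
    using G(2) \<open>e > 0\<close> by (intro tendstoD) auto
  then show "\<forall>\<^sub>F z in at 0. dist (L1_modulus F z) 0 < e"
  proof eventually_elim
    case (elim z)
    then show ?case
      using L1_modulus_approx[OF F G(1), of z] G(3) L1_modulus_nonneg[of F z] by auto
  qed
qed

text \<open>At boundary points the difference of the indicators need not tend to 0, but its
  one-sided part \<open>?P\<close> does: a point of an open set stays in it under small shifts.
  Translation invariance gives the positive and negative parts of the difference the same integral,
  so the modulus is twice the integral of \<open>?P\<close>.\<close>

lemma L1_modulus_tendsto_open:
  fixes U :: "'a::euclidean_space set"
  assumes U: "open U" "emeasure lborel U < \<infinity>"
  shows "(L1_modulus (indicator U) \<longlongrightarrow> 0) (at 0)"
proof -
  have [measurable]: "U \<in> sets borel" using U by auto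
  have I: "integrable lborel (indicat_real U)" using U by auto
  let ?P = "\<lambda>z x. max 0 (indicat_real U x - indicat_real U (x + z))"
  have intP: "integrable lborel (?P z)" for z
    using lborel_integrable_translation[OF I, of z] I by auto
  have eq: "L1_modulus (indicator U) z = 2 * (LINT x|lborel. ?P z x)" for z
  proof -
    have "L1_modulus (indicator U) z = (LINT x|lborel. 2 * ?P z x - (indicat_real U x - indicat_real U (x + z)))"
      unfolding L1_modulus_def by (rule Bochner_Integration.integral_cong) (auto simp: indicator_def)
    also have "\<dots> = 2 * (LINT x|lborel. ?P z x)
        - ((LINT x|lborel. indicat_real U x) - (LINT x|lborel. indicat_real U (x + z)))"
      using intP[of z] I lborel_integrable_translation[OF I, of z] by simp
    also have "(LINT x|lborel. indicat_real U (x + z)) = (LINT x|lborel. indicat_real U x)"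
      by (rule lborel_integral_translation) auto
    finally show ?thesis by simp
  qed
  have "((\<lambda>z. LINT x|lborel. ?P z x) \<longlongrightarrow> 0) (at 0)"
    unfolding tendsto_at_iff_sequentially comp_def
  proof (intro allI impI)
    fix Z :: "nat \<Rightarrow> 'a" assume Z: "Z \<longlonglongrightarrow> 0"
    have "(\<lambda>n. LINT x|lborel. ?P (Z n) x) \<longlonglongrightarrow> (LINT x::'a|lborel. (0::real))"
    proof (rule integral_dominated_convergence[where w="indicat_real U"])
      show "AE x in lborel. (\<lambda>n. ?P (Z n) x) \<longlonglongrightarrow> 0"
      proof (rule AE_I2)
        fix x :: 'a
        show "(\<lambda>n. ?P (Z n) x) \<longlonglongrightarrow> 0"
        proof (cases "x \<in> U")
          case True
          have "(\<lambda>n. x + Z n) \<longlonglongrightarrow> x" using tendsto_add[OF tendsto_const Z, of x] by simp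
          then have "\<forall>\<^sub>F n in sequentially. x + Z n \<in> U"
            using U(1) True by (rule topological_tendstoD)
          then have "\<forall>\<^sub>F n in sequentially. ?P (Z n) x = 0"
            using True by (auto elim: eventually_mono)
          then show ?thesis by (rule tendsto_eventually)
        next
          case False
          then show ?thesis by (simp add: indicator_def)
        qed
      qed
    qed (use I in \<open>auto simp: indicator_def\<close>)
    then show "(\<lambda>n. LINT x|lborel. ?P (Z n) x) \<longlonglongrightarrow> 0" by simp
  qed
  from tendsto_mult[OF tendsto_const[of 2] this] show ?thesis
    by (simp add: eq[abs_def])
qed

text \<open>Indicators of Borel sets of finite measure reduce to open sets by outer regularity, sums
  to subadditivity of the modulus, and limits to closedness in \<open>L^1\<close>.\<close>

lemma L1_modulus_tendsto:
  fixes F :: "'a::euclidean_space \<Rightarrow> real"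
  assumes "integrable lborel F"
  shows "(L1_modulus F \<longlongrightarrow> 0) (at 0)"
  using assms
proof (induction rule: integrable_induct)
  case (base A c)
  then have [measurable]: "A \<in> sets borel" by simp
  have IA: "integrable lborel (indicat_real A)" using base by auto
  have "(L1_modulus (indicat_real A) \<longlongrightarrow> 0) (at 0)"
  proof (rule L1_modulus_tendsto_limit[OF IA])
    fix e :: real assume "e > 0"
    then obtain U where U: "open U" "A \<subseteq> U" "emeasure lborel (U - A) < e"
      using outer_regular_lborel[of A e] by auto
    have [measurable]: "U \<in> sets borel" using U by auto
    have "emeasure lborel U \<le> emeasure lborel A + emeasure lborel (U - A)"
      using U(2) by (subst plus_emeasure) (auto simp: Un_absorb1)
    also have "\<dots> < \<infinity>" using base U(3) by (auto simp: ennreal_add_less_top intro: order.strict_trans)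
    finally have fin: "emeasure lborel U < \<infinity>" .
    then have IU: "integrable lborel (indicat_real U)" by auto
    have "(LINT x|lborel. \<bar>indicat_real A x - indicat_real U x\<bar>) = (LINT x|lborel. indicat_real (U - A) x)"
      using U(2) by (intro Bochner_Integration.integral_cong) (auto simp: indicator_def)
    also have "\<dots> = measure lborel (U - A)" by simp
    also have "\<dots> < e"
      using U(3) \<open>e > 0\<close> by (simp add: measure_def enn2real_less_iff order.strict_trans[OF U(3)])
    finally show "\<exists>G. integrable lborel G \<and> (L1_modulus G \<longlongrightarrow> 0) (at 0) \<and> (LINT x|lborel. \<bar>indicat_real A x - G x\<bar>) < e"
      using IU L1_modulus_tendsto_open[OF U(1) fin] by blast
  qed
  moreover have "L1_modulus (\<lambda>x. indicat_real A x *\<^sub>R c) z = L1_modulus (indicat_real A) z * \<bar>c\<bar>" for z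
    by (simp add: L1_modulus_def left_diff_distrib[symmetric] abs_mult)
  ultimately show ?case
    by (simp add: tendsto_mult_left_zero)
next
  case (add f g)
  show ?case
  proof (rule Lim_null_comparison)
    show "\<forall>\<^sub>F z in at 0. norm (L1_modulus (\<lambda>x. f x + g x) z) \<le> L1_modulus f z + L1_modulus g z"
    proof (rule always_eventually, rule allI)
      fix z
      have "L1_modulus (\<lambda>x. f x + g x) z \<le> (LINT x|lborel. \<bar>f (x + z) - f x\<bar> + \<bar>g (x + z) - g x\<bar>)"
        unfolding L1_modulus_def using add
        by (intro Bochner_Integration.integral_mono L1_modulus_integrable Bochner_Integration.integrable_add) auto
      also have "\<dots> = L1_modulus f z + L1_modulus g z"
        unfolding L1_modulus_def using add by (intro Bochner_Integration.integral_add L1_modulus_integrable)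
      finally show "norm (L1_modulus (\<lambda>x. f x + g x) z) \<le> L1_modulus f z + L1_modulus g z"
        using L1_modulus_nonneg[of "\<lambda>x. f x + g x" z] by simp
    qed
    show "((\<lambda>z. L1_modulus f z + L1_modulus g z) \<longlongrightarrow> 0) (at 0)"
      using tendsto_add[OF add(3,4)] by simp
  qed
next
  case (lim f s)
  show ?case
  proof (rule L1_modulus_tendsto_limit[OF lim(4)])
    fix e :: real assume "e > 0"
    have "(\<lambda>i. LINT x|lborel. \<bar>f x - s i x\<bar>) \<longlonglongrightarrow> (LINT x::'a|lborel. (0::real))"
    \<comment> \<open>The approximants of the induction rule satisfy
      \<open>\<bar>s i x\<bar> \<le> 2 * \<bar>f x\<bar>\<close>, hence the factor 3.\<close>
    proof (rule integral_dominated_convergence[where w="\<lambda>x. 3 * \<bar>f x\<bar>"])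
      show "AE x in lborel. (\<lambda>i. \<bar>f x - s i x\<bar>) \<longlonglongrightarrow> 0"
        using lim(2) by (auto intro!: AE_I2 tendsto_rabs_zero tendsto_eq_intros)
      show "AE x in lborel. norm \<bar>f x - s i x\<bar> \<le> 3 * \<bar>f x\<bar>" for i
      proof (rule AE_I2)
        fix x :: 'a
        show "norm \<bar>f x - s i x\<bar> \<le> 3 * \<bar>f x\<bar>"
          using lim(3)[of x i] by simp
      qed
    qed (use lim in \<open>auto dest!: borel_measurable_integrable\<close>)
    then have "(\<lambda>i. LINT x|lborel. \<bar>f x - s i x\<bar>) \<longlonglongrightarrow> 0" by simp
    from order_tendstoD(2)[OF this \<open>e > 0\<close>]
    obtain i where "(LINT x|lborel. \<bar>f x - s i x\<bar>) < e"
      by (auto simp: eventually_sequentially)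
    with lim(1,5) show "\<exists>G. integrable lborel G \<and> (L1_modulus G \<longlongrightarrow> 0) (at 0) \<and> (LINT x|lborel. \<bar>f x - G x\<bar>) < e"
      by blast
  qed
qed

subsection \<open>Mollification\<close>

definition mollifier :: "nat \<Rightarrow> real^'d \<Rightarrow> real" where
  "mollifier n z = bump (1 / Suc n) z * (1 / (LINT x|lborel. bump (1 / Suc n) (x::real^'d)))"

definition mollify :: "nat \<Rightarrow> (real^'d \<Rightarrow> real) \<Rightarrow> real^'d \<Rightarrow> real" where
  "mollify n f = conv f (mollifier n)"

lemma locally_integrable_1: "locally_integrable (\<lambda>x. 1)"
  unfolding locally_integrable_def set_integrable_def
  using emeasure_bounded_finite[OF compact_imp_bounded]
  by (auto intro!: integrable_real_indicator simp: compact_imp_closed borel_closed)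

lemma test_function_integrable: "test_function \<psi> \<Longrightarrow> integrable lborel \<psi>"
  using locally_integrable_mult_test[OF locally_integrable_1] by simp

lemma integral_bump_pos:
  assumes "r > 0"
  shows "(LINT x|lborel. bump r (x::real^'d)) > 0"
proof -
  have I: "integrable lborel (bump r :: real^'d \<Rightarrow> real)"
    by (rule test_function_integrable[OF test_function_bump[OF assms]])
  have "(LINT x|lborel. bump r (x::real^'d)) \<noteq> 0"
  proof
    assume "(LINT x|lborel. bump r (x::real^'d)) = 0"
    then have "AE x in lborel. bump r (x::real^'d) = 0"
      using integral_nonneg_eq_0_iff_AE[OF I] by (simp add: bump_nonneg)
    then have "AE x in lborel. (x::real^'d) \<notin> ball 0 r"
      by eventually_elim (use bump_nonzero_iff[OF assms, where 'd='d] in auto)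
    then have "emeasure lborel (ball (0::real^'d) r) = 0"
      by (subst (asm) AE_iff_measurable[of "ball 0 r"]) auto
    then have "negligible (ball (0::real^'d) r)"
      by (simp add: negligible_iff_null_sets null_sets_completionI null_sets_def)
    then show False
      using open_not_negligible[OF open_ball, of "0::real^'d" r] assms by auto
  qed
  then show ?thesis
    by (simp add: less_le bump_nonneg integral_nonneg_AE)
qed

lemma test_function_mollifier: "test_function (mollifier n)"
  unfolding mollifier_def[abs_def] by (intro test_function_mult test_function_bump Ck_const) simp

lemma mollifier_nonneg: "0 \<le> mollifier n z"
  by (simp add: mollifier_def bump_nonneg integral_nonneg_AE)

lemma mollifier_integral: "(LINT z|lborel. mollifier n (z::real^'d)) = 1"
  using integral_bump_pos[of "1 / Suc n", where 'd='d] by (simp add: mollifier_def)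

lemma mollifier_support: "mollifier n z \<noteq> 0 \<Longrightarrow> norm z < 1 / Suc n"
  using bump_nonzero_iff[of "1 / Suc n" z] by (auto simp: mollifier_def)

lemma mollifier_even: "mollifier n (- z) = mollifier n z"
  by (simp add: mollifier_def bump_def)

lemma measurable_test_function:
  assumes "test_function \<psi>"
  shows "\<psi> \<in> borel_measurable borel"
  by (rule borel_measurable_continuous_onI[OF test_function_continuous[OF assms]])

lemma measurable_mollifier[measurable]: "mollifier n \<in> borel_measurable borel"
  by (rule measurable_test_function[OF test_function_mollifier])

lemma integrable_mollifier_reflect: "integrable lborel (\<lambda>y. mollifier n (x - y))"
  by (rule test_function_integrable[OF test_function_reflect[OF test_function_mollifier]])

lemma mollifier_integral_reflect: "(LINT y|lborel. mollifier n (x - y :: real^'d)) = 1"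
proof -
  have "(LINT y|lborel. mollifier n (x - y :: real^'d)) = (LINT y|lborel. mollifier n (y + - x))"
    using mollifier_even[of n "x - y" for y] by (intro Bochner_Integration.integral_cong) (auto simp: algebra_simps)
  also have "\<dots> = 1"
    by (subst lborel_integral_translation) (auto simp: mollifier_integral)
  finally show ?thesis .
qed

lemma mollify_alt:
  assumes [measurable]: "f \<in> borel_measurable borel"
  shows "mollify n f x = (LINT w|lborel. f (w + x) * mollifier n w)"
proof -
  have "mollify n f x = (LINT y|lborel. f y * mollifier n (y + - x))"
    unfolding mollify_def conv_def
    using mollifier_even[of n "x - y" for y] by (intro Bochner_Integration.integral_cong) (auto simp: algebra_simps)
  also have "\<dots> = (LINT w|lborel. f (w + x) * mollifier n (w + x + - x))"
    by (rule lborel_integral_translation[symmetric]) measurable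
  finally show ?thesis by simp
qed

lemma Ck_mollify: "locally_integrable f \<Longrightarrow> Ck k (mollify n f)"
  unfolding mollify_def by (intro Ck_conv test_function_mollifier)

lemma continuous_mollify: "locally_integrable f \<Longrightarrow> continuous_on UNIV (mollify n f)"
  using Ck_mollify[of f 0] by simp

lemma measurable_mollify: "locally_integrable f \<Longrightarrow> mollify n f \<in> borel_measurable borel"
  by (rule borel_measurable_continuous_onI[OF continuous_mollify])

text \<open>The mollifier has mass 1, so \<open>mollify n F x - F x\<close> averages
  \<open>F (x + w) - F x\<close> over small \<open>w\<close>; exchanging the integrals leaves an
  average of the modulus. The nonnegative integral is used so that the exchange is justified before
  the finiteness of either side is known.\<close>

lemma L1_mollify_le:
  fixes F :: "real^'d \<Rightarrow> real"
  assumes F: "integrable lborel F" and e: "\<And>w. norm w < 1 / Suc n \<Longrightarrow> L1_modulus F w \<le> e"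
  shows "(\<integral>\<^sup>+x. ennreal \<bar>mollify n F x - F x\<bar> \<partial>lborel) \<le> ennreal e"
proof -
  have e0: "0 \<le> e" using e[of 0] L1_modulus_nonneg[of F 0] by simp
  have [measurable]: "F \<in> borel_measurable borel" using F by auto
  have mi: "integrable lborel (mollifier n :: real^'d \<Rightarrow> real)"
    by (rule test_function_integrable[OF test_function_mollifier])
  have "(\<integral>\<^sup>+x. ennreal \<bar>mollify n F x - F x\<bar> \<partial>lborel)
      \<le> (\<integral>\<^sup>+x. \<integral>\<^sup>+w. ennreal (\<bar>F (x + w) - F x\<bar> * mollifier n w) \<partial>lborel \<partial>lborel)"
  proof (rule nn_integral_mono)
    fix x :: "real^'d"
    have "locally_integrable (\<lambda>w. F (w + x))"
      by (intro integrable_imp_locally_integrable lborel_integrable_translation F)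
    from locally_integrable_mult_test[OF this test_function_mollifier]
    have I: "integrable lborel (\<lambda>w. F (w + x) * mollifier n w)" .
    have "mollify n F x - F x = (LINT w|lborel. F (w + x) * mollifier n w - F x * mollifier n w)"
      using I mi by (simp add: mollify_alt mollifier_integral)
    also have "ennreal \<bar>\<dots>\<bar> \<le> (\<integral>\<^sup>+w. norm (F (w + x) * mollifier n w - F x * mollifier n w) \<partial>lborel)"
      using integral_norm_bound_ennreal[of lborel "\<lambda>w. F (w + x) * mollifier n w - F x * mollifier n w"] I mi by auto
    also have "\<dots> = (\<integral>\<^sup>+w. ennreal (\<bar>F (x + w) - F x\<bar> * mollifier n w) \<partial>lborel)"
      by (intro nn_integral_cong) (simp add: left_diff_distrib[symmetric] abs_mult mollifier_nonneg add.commute)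
    finally show "ennreal \<bar>mollify n F x - F x\<bar> \<le> (\<integral>\<^sup>+w. ennreal (\<bar>F (x + w) - F x\<bar> * mollifier n w) \<partial>lborel)" .
  qed
  also have "\<dots> = (\<integral>\<^sup>+w. \<integral>\<^sup>+x. ennreal (\<bar>F (x + w) - F x\<bar> * mollifier n w) \<partial>lborel \<partial>lborel)"
    by (rule lborel_pair.Fubini'[symmetric]) measurable
  also have "\<dots> = (\<integral>\<^sup>+w. ennreal (L1_modulus F w * mollifier n w) \<partial>lborel)"
  proof (rule nn_integral_cong)
    fix w :: "real^'d"
    have "(\<integral>\<^sup>+x. ennreal (\<bar>F (x + w) - F x\<bar> * mollifier n w) \<partial>lborel)
       = ennreal (LINT x|lborel. \<bar>F (x + w) - F x\<bar> * mollifier n w)"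
      by (rule nn_integral_eq_integral) (auto intro!: L1_modulus_integrable F simp: mollifier_nonneg)
    then show "(\<integral>\<^sup>+x. ennreal (\<bar>F (x + w) - F x\<bar> * mollifier n w) \<partial>lborel) = ennreal (L1_modulus F w * mollifier n w)"
      by (simp add: L1_modulus_def)
  qed
  also have "\<dots> \<le> (\<integral>\<^sup>+w. ennreal (e * mollifier n (w :: real^'d)) \<partial>lborel)"
  proof (intro nn_integral_mono ennreal_leI)
    fix w :: "real^'d"
    show "L1_modulus F w * mollifier n w \<le> e * mollifier n w"
      using e[of w] mollifier_support[of n w] mollifier_nonneg[of n w]
      by (cases "mollifier n w = 0") (auto intro: mult_right_mono)
  qed
  also have "\<dots> = ennreal (LINT w|lborel. e * mollifier n (w :: real^'d))"
    by (rule nn_integral_eq_integral) (use mi e0 in \<open>auto simp: mollifier_nonneg\<close>)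
  also have "\<dots> = ennreal e" by (simp add: mollifier_integral)
  finally show ?thesis .
qed

lemma L1_mollify_tendsto:
  fixes F :: "real^'d \<Rightarrow> real"
  assumes F: "integrable lborel F"
  shows "(\<lambda>n. \<integral>\<^sup>+x. ennreal \<bar>mollify n F x - F x\<bar> \<partial>lborel) \<longlonglongrightarrow> 0"
proof (rule tendsto_zero_ennreal)
  fix r :: real assume "r > 0"
  then have "\<forall>\<^sub>F z in at 0. dist (L1_modulus F z) 0 < r / 2"
    by (intro tendstoD[OF L1_modulus_tendsto[OF F]]) auto
  then obtain d where d: "d > 0" "\<And>z. z \<noteq> 0 \<Longrightarrow> norm z < d \<Longrightarrow> \<bar>L1_modulus F z\<bar> < r / 2"
    by (auto simp: eventually_at)
  have le: "L1_modulus F z \<le> r / 2" if "norm z < d" for z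
    using d(2)[of z] that \<open>r > 0\<close> by (cases "z = 0") (auto simp: L1_modulus_def)
  have "(\<lambda>n. 1 / real (Suc n)) \<longlonglongrightarrow> 0"
    using LIMSEQ_inverse_real_of_nat by (simp add: inverse_eq_divide)
  from order_tendstoD(2)[OF this d(1)]
  show "\<forall>\<^sub>F n in sequentially. (\<integral>\<^sup>+x. ennreal \<bar>mollify n F x - F x\<bar> \<partial>lborel) < ennreal r"
  proof eventually_elim
    case (elim n)
    have "(\<integral>\<^sup>+x. ennreal \<bar>mollify n F x - F x\<bar> \<partial>lborel) \<le> ennreal (r / 2)"
      by (rule L1_mollify_le[OF F le]) (use elim in auto)
    also have "\<dots> < ennreal r" using \<open>r > 0\<close> by (simp add: ennreal_lessI)
    finally show ?case .
  qed
qed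

lemma mollify_L1_local:
  fixes f :: "real^'d \<Rightarrow> real"
  assumes f: "locally_integrable f"
  shows "(\<lambda>n. LINT x|lborel. indicator (cball 0 R) x * \<bar>mollify n f x - f x\<bar>) \<longlonglongrightarrow> 0"
proof -
  have [measurable]: "f \<in> borel_measurable borel" "mollify n f \<in> borel_measurable borel" for n
    by (rule locally_integrable_measurable[OF f], rule measurable_mollify[OF f])
  \<comment> \<open>The mollifiers live in the unit ball, so truncating \<open>f\<close> one unit
    beyond \<open>R\<close> leaves its mollifications on the ball of radius \<open>R\<close>
    unchanged.\<close>
  define F where "F x = indicator (cball 0 (R + 1)) x * f x" for x
  have F: "integrable lborel F"
    using f by (simp add: F_def[abs_def] locally_integrable_def set_integrable_def)
  have eq: "mollify n F x = mollify n f x" if "norm x \<le> R" for n x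
  proof -
    have "F y * mollifier n (x - y) = f y * mollifier n (x - y)" for y
    proof (cases "mollifier n (x - y) = 0")
      case False
      then have "norm (x - y) < 1" using mollifier_support[of n "x - y"] by (auto elim!: order.strict_trans2)
      then have "norm y \<le> R + 1" using that norm_triangle_ineq2[of y x] by (simp add: norm_minus_commute)
      then show ?thesis by (simp add: F_def)
    qed simp
    then show ?thesis unfolding mollify_def conv_def by (simp only:)
  qed
  have lim: "(\<lambda>n. enn2real (\<integral>\<^sup>+x. ennreal \<bar>mollify n F x - F x\<bar> \<partial>lborel)) \<longlonglongrightarrow> 0"
    using L1_mollify_tendsto[OF F] by (intro tendsto_enn2real) auto
  have fin: "\<forall>\<^sub>F n in sequentially. (\<integral>\<^sup>+x. ennreal \<bar>mollify n F x - F x\<bar> \<partial>lborel) < 1"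
    by (rule order_tendstoD(2)[OF L1_mollify_tendsto[OF F]]) simp
  show ?thesis
  proof (rule Lim_null_comparison[OF _ lim])
    show "\<forall>\<^sub>F n in sequentially. norm (LINT x|lborel. indicator (cball 0 R) x * \<bar>mollify n f x - f x\<bar>)
        \<le> enn2real (\<integral>\<^sup>+x. ennreal \<bar>mollify n F x - F x\<bar> \<partial>lborel)"
      using fin
    proof eventually_elim
      case (elim n)
      have "(LINT x|lborel. indicator (cball 0 R) x * \<bar>mollify n f x - f x\<bar>)
          = enn2real (\<integral>\<^sup>+x. ennreal (indicator (cball 0 R) x * \<bar>mollify n f x - f x\<bar>) \<partial>lborel)"
        by (rule integral_eq_nn_integral) (measurable, auto)
      also have "\<dots> \<le> enn2real (\<integral>\<^sup>+x. ennreal \<bar>mollify n F x - F x\<bar> \<partial>lborel)"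
      proof (rule enn2real_mono)
        show "(\<integral>\<^sup>+x. ennreal (indicator (cball 0 R) x * \<bar>mollify n f x - f x\<bar>) \<partial>lborel)
            \<le> (\<integral>\<^sup>+x. ennreal \<bar>mollify n F x - F x\<bar> \<partial>lborel)"
          by (intro nn_integral_mono ennreal_leI) (auto simp: indicator_def eq F_def)
      qed (use elim in \<open>auto intro: order.strict_trans\<close>)
      finally show ?case by (simp add: integral_nonneg_AE)
    qed
  qed
qed

subsection \<open>Functions with bounded weak derivatives\<close>

lemma has_weak_partial_derivD:
  assumes "has_weak_partial_deriv j f g"
  shows "locally_integrable f" "locally_integrable g"
    "test_function \<psi> \<Longrightarrow> (LINT x|lborel. f x * partial_deriv j \<psi> x) = - (LINT x|lborel. g x * \<psi> x)"
  using assms by (auto simp: has_weak_partial_deriv_def)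

lemma partial_deriv_mollify:
  "has_weak_partial_deriv j f g \<Longrightarrow> partial_deriv j (mollify n f) x = mollify n g x"
  unfolding mollify_def by (rule partial_deriv_conv_weak[OF _ test_function_mollifier])

lemma mollify_bounded:
  fixes g :: "real^'d \<Rightarrow> real"
  assumes g: "locally_integrable g" and C: "AE x in lborel. \<bar>g x\<bar> \<le> C"
  shows "\<bar>mollify n g x\<bar> \<le> C"
proof -
  have I: "integrable lborel (\<lambda>y. g y * mollifier n (x - y))"
    by (rule locally_integrable_mult_test[OF g test_function_reflect[OF test_function_mollifier]])
  have "\<bar>mollify n g x\<bar> \<le> (LINT y|lborel. \<bar>g y * mollifier n (x - y)\<bar>)"
    unfolding mollify_def conv_def by (rule integral_abs_bound)
  also have "\<dots> \<le> (LINT y|lborel. C * mollifier n (x - y))"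
  proof (rule integral_mono_AE)
    show "AE y in lborel. \<bar>g y * mollifier n (x - y)\<bar> \<le> C * mollifier n (x - y)"
      using C by eventually_elim (simp add: abs_mult mollifier_nonneg mult_right_mono)
  qed (use I integrable_mollifier_reflect in auto)
  also have "\<dots> = C"
    by (simp add: mollifier_integral_reflect)
  finally show ?thesis .
qed

lemma mollify_nonneg: "(\<And>x. 0 \<le> f x) \<Longrightarrow> 0 \<le> mollify n f x"
  by (simp add: mollify_def conv_def mollifier_nonneg)

lemma Lipschitz_partial_deriv_bound:
  fixes u :: "real^'d \<Rightarrow> real"
  assumes "\<And>x. u differentiable at x" and C: "\<And>j x. \<bar>partial_deriv j u x\<bar> \<le> C j"
  shows "\<bar>u x - u y\<bar> \<le> (\<Sum>j\<in>UNIV. C j) * norm (x - y)"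
proof -
  have C0: "0 \<le> C j" for j using C[of j 0] by simp
  have "norm (u x - u y) \<le> (\<Sum>j\<in>UNIV. C j) * norm (x - y)"
  proof (rule differentiable_bound[of UNIV u "\<lambda>x v. \<Sum>j\<in>UNIV. v $ j * partial_deriv j u x"])
    fix x
    show "onorm (\<lambda>v. \<Sum>j\<in>UNIV. v $ j * partial_deriv j u x) \<le> (\<Sum>j\<in>UNIV. C j)"
    proof (rule onorm_bound)
      fix v :: "real^'d"
      have "\<bar>\<Sum>j\<in>UNIV. v $ j * partial_deriv j u x\<bar> \<le> (\<Sum>j\<in>UNIV. C j * norm v)"
        using C C0
        by (intro order_trans[OF sum_abs] sum_mono)
           (metis abs_ge_zero abs_mult component_le_norm_cart mult.commute mult_mono)
      then show "norm (\<Sum>j\<in>UNIV. v $ j * partial_deriv j u x) \<le> (\<Sum>j\<in>UNIV. C j) * norm v"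
        by (simp add: sum_distrib_right)
    qed (intro sum_nonneg C0)
  qed (use has_derivative_partial_deriv[OF assms(1)] in auto)
  then show ?thesis by simp
qed

lemma locally_integrable_continuous:
  "continuous_on UNIV f \<Longrightarrow> locally_integrable f"
  unfolding locally_integrable_def set_integrable_def
  by (intro allI impI borel_integrable_compact) (auto intro: continuous_on_subset)

lemma locally_integrable_bound:
  assumes "locally_integrable f" "g \<in> borel_measurable borel" "\<And>x. \<bar>g x\<bar> \<le> \<bar>f x\<bar>"
  shows "locally_integrable g"
  unfolding locally_integrable_def
proof (intro allI impI)
  fix K :: "(real^'a) set" assume "compact K"
  then have "set_integrable lborel K f" using assms(1) by (simp add: locally_integrable_def)
  then show "set_integrable lborel K g"
    unfolding set_integrable_def
    by (rule Bochner_Integration.integrable_bound)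
       (use assms \<open>compact K\<close> in \<open>auto simp: compact_imp_closed borel_closed abs_mult mult_left_mono\<close>)
qed

lemma locally_integrable_cball:
  "locally_integrable f \<Longrightarrow> integrable lborel (\<lambda>x. indicator (cball 0 R) x * f x)"
  by (simp add: locally_integrable_def set_integrable_def)

lemma locally_integrable_abs_diff:
  assumes "locally_integrable f" "locally_integrable g"
  shows "integrable lborel (\<lambda>x. indicator (cball 0 R) x * \<bar>f x - g x\<bar>)"
  using integrable_abs[OF Bochner_Integration.integrable_diff[OF assms[THEN locally_integrable_cball]], of R R]
  by (simp add: right_diff_distrib[symmetric] abs_mult)

lemma integrable_indicator_cball:
  "integrable lborel (\<lambda>x::'a::euclidean_space. indicator (cball 0 R) x * (c::real))"
  by (auto intro!: integrable_real_indicator emeasure_bounded_finite)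

text \<open>The mollifications are uniformly Lipschitz, and bounded at the origin because their averages
  over the unit ball converge.\<close>

lemma weak_derivative_linear_growth:
  fixes f :: "real^'d \<Rightarrow> real"
  assumes wk: "\<And>j. has_weak_partial_deriv j f (g j)" and bd: "\<And>j. AE x in lborel. \<bar>g j x\<bar> \<le> C j"
  shows "\<exists>K\<ge>0. AE x in lborel. \<bar>f x\<bar> \<le> K * (1 + norm x)"
proof -
  note f = has_weak_partial_derivD(1)[OF wk]
  define L where "L = (\<Sum>j\<in>UNIV. C j)"
  define V where "V = measure lborel (cball (0::real^'d) 1)"
  define a where "a R n = (LINT x|lborel. indicator (cball 0 R) x * \<bar>mollify n f x - f x\<bar>)" for R n
  \<comment> \<open>The average of the absolute value of \<open>f\<close> over the unit ball, plus
    the Lipschitz cost \<open>L\<close> of reaching the origin from a point of that ball.\<close>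
  define K where "K = (LINT x|lborel. indicator (cball 0 1) x * \<bar>f x\<bar>) / V + L"
  have a: "a R \<longlonglongrightarrow> 0" for R unfolding a_def[abs_def] by (rule mollify_L1_local[OF f])
  have [measurable]: "f \<in> borel_measurable borel" by (rule locally_integrable_measurable[OF f])
  have V: "V > 0" unfolding V_def by (simp add: content_cball_pos)
  have Cn: "\<bar>mollify n (g j) x\<bar> \<le> C j" for n j x
    by (rule mollify_bounded[OF has_weak_partial_derivD(2)[OF wk] bd])
  have C0: "0 \<le> C j" for j using Cn[of 0 j 0] by simp
  have L: "L \<ge> 0" unfolding L_def by (intro sum_nonneg C0)
  have lip: "\<bar>mollify n f x - mollify n f y\<bar> \<le> L * norm (x - y)" for n x y
    unfolding L_def
    by (rule Lipschitz_partial_deriv_bound)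
       (use Ck_differentiable[OF Ck_mollify[OF f]] Cn in \<open>auto simp: partial_deriv_mollify[OF wk]\<close>)
  have lm: "locally_integrable (mollify n f)" for n
    by (rule locally_integrable_continuous[OF continuous_mollify[OF f]])
  have absf: "locally_integrable (\<lambda>x. \<bar>f x\<bar>)" by (rule locally_integrable_bound[OF f]) auto
  have K: "K \<ge> 0" unfolding K_def using V L by (auto intro!: add_nonneg_nonneg divide_nonneg_pos integral_nonneg_AE)
  have at0: "\<bar>mollify n f 0\<bar> \<le> K + a 1 n / V" for n
  proof -
    have "V * \<bar>mollify n f 0\<bar> = (LINT x::real^'d|lborel. indicator (cball 0 1) x * \<bar>mollify n f 0\<bar>)"
      by (simp add: V_def)
    also have "\<dots> \<le> (LINT x|lborel. indicator (cball 0 1) x * \<bar>f x\<bar> +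
        indicator (cball 0 1) x * \<bar>mollify n f x - f x\<bar> + indicator (cball 0 1) x * L)"
    proof (rule Bochner_Integration.integral_mono)
      fix x :: "real^'d"
      have "\<bar>mollify n f 0\<bar> \<le> \<bar>f x\<bar> + \<bar>mollify n f x - f x\<bar> + L" if "norm x \<le> 1"
        using lip[of n x 0] mult_left_mono[OF that L] by auto
      then show "indicator (cball 0 1) x * \<bar>mollify n f 0\<bar> \<le> indicator (cball 0 1) x * \<bar>f x\<bar> +
        indicator (cball 0 1) x * \<bar>mollify n f x - f x\<bar> + indicator (cball 0 1) x * L"
        by (auto simp: indicator_def)
    qed (intro Bochner_Integration.integrable_add locally_integrable_cball[OF absf]
           locally_integrable_abs_diff[OF lm f] integrable_indicator_cball)+
    also have "\<dots> = V * K + a 1 n"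
    proof -
      have "integrable lborel (\<lambda>x::real^'d. indicator (cball 0 1) x * L)"
        by (rule integrable_indicator_cball)
      moreover have "(LINT x::real^'d|lborel. indicator (cball 0 1) x * L) = V * L"
        by (simp add: V_def)
      ultimately show ?thesis
        using V locally_integrable_cball[OF absf, of 1] locally_integrable_abs_diff[OF lm f, of 1 n]
        by (simp add: K_def a_def distrib_left)
    qed
    finally show ?thesis using V by (simp add: field_simps)
  qed
  have est: "\<bar>f x\<bar> - K - L * norm x \<le> \<bar>mollify n f x - f x\<bar> + a 1 n / V" for n x
    using at0[of n] lip[of n x 0] by auto
  have ball: "AE x in lborel. norm x \<le> R \<longrightarrow> \<bar>f x\<bar> \<le> K + L * norm x" for R :: real
  proof -
    have [measurable]: "cball (0::real^'d) R \<in> sets borel" by simp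
    \<comment> \<open>The excess of \<open>\<bar>f x\<bar>\<close> over the claimed bound. Its
      integral does not depend on \<open>n\<close>, yet it is at most a mollification error tending
      to 0, so the excess vanishes almost everywhere on the ball.\<close>
    let ?w = "\<lambda>x. indicator (cball 0 R) x * max 0 (\<bar>f x\<bar> - K - L * norm x)"
    have I: "integrable lborel ?w"
    proof (rule Bochner_Integration.integrable_bound[OF locally_integrable_cball[OF absf, of R]])
      have "0 \<le> K + L * norm x" for x :: "real^'d" using K L by simp
      then have "max 0 (\<bar>f x\<bar> - K - L * norm x) \<le> \<bar>f x\<bar>" for x
        by (smt (verit))
      then show "AE x in lborel. norm (?w x) \<le> norm (indicator (cball 0 R) x * \<bar>f x\<bar>)"
        by (intro AE_I2) (auto simp: indicator_def)
    qed measurable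
    have "(LINT x|lborel. ?w x) \<le> a R n + measure lborel (cball (0::real^'d) R) * (a 1 n / V)" for n
    proof -
      have "(LINT x|lborel. ?w x) \<le> (LINT x|lborel. indicator (cball 0 R) x * \<bar>mollify n f x - f x\<bar>
          + indicator (cball 0 R) x * (a 1 n / V))"
      proof (rule Bochner_Integration.integral_mono[OF I])
        fix x
        have "0 \<le> a 1 n / V" using V by (simp add: a_def integral_nonneg_AE)
        then show "?w x \<le> indicator (cball 0 R) x * \<bar>mollify n f x - f x\<bar> + indicator (cball 0 R) x * (a 1 n / V)"
          using est[of x n] by (auto simp: indicator_def)
      qed (intro Bochner_Integration.integrable_add locally_integrable_abs_diff[OF lm f]
             integrable_indicator_cball)
      also have "\<dots> = a R n + measure lborel (cball (0::real^'d) R) * (a 1 n / V)"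
        by (subst Bochner_Integration.integral_add[OF locally_integrable_abs_diff[OF lm f] integrable_indicator_cball])
           (simp add: a_def)
      finally show ?thesis .
    qed
    moreover have "(\<lambda>n. a R n + measure lborel (cball (0::real^'d) R) * (a 1 n / V)) \<longlonglongrightarrow> 0 + measure lborel (cball (0::real^'d) R) * (0 / V)"
      using V by (intro tendsto_intros a) auto
    ultimately have "(LINT x|lborel. ?w x) \<le> 0"
      by (intro LIMSEQ_le_const[where a="LINT x|lborel. ?w x"]) auto
    moreover have "0 \<le> (LINT x|lborel. ?w x)"
      by (intro integral_nonneg_AE) (auto simp: indicator_def)
    ultimately have "(LINT x|lborel. ?w x) = 0" by (rule antisym)
    then have "AE x in lborel. ?w x = 0"
      using integral_nonneg_eq_0_iff_AE[OF I] by simp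
    then show ?thesis
      by eventually_elim (auto simp: indicator_def max_def split: if_splits)
  qed
  have "AE x in lborel. \<forall>n::nat. norm x \<le> n \<longrightarrow> \<bar>f x\<bar> \<le> K + L * norm x"
    unfolding AE_all_countable using ball by blast
  then have "AE x in lborel. \<bar>f x\<bar> \<le> (K + L) * (1 + norm x)"
  proof eventually_elim
    case (elim x)
    obtain n :: nat where "norm x \<le> n" using real_arch_simple by blast
    with elim have "\<bar>f x\<bar> \<le> K + L * norm x" by blast
    also have "\<dots> \<le> (K + L) * (1 + norm x)" using K L by (simp add: algebra_simps)
    finally show ?case .
  qed
  with K L show ?thesis by (intro exI[of _ "K + L"]) auto
qed

lemma L1_local_weighted_limit:
  fixes F :: "nat \<Rightarrow> real^'d \<Rightarrow> real"
  assumes Fn: "\<And>n. locally_integrable (F n)" and G: "locally_integrable G"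
    and w: "w \<in> borel_measurable borel" "AE x in lborel. \<bar>w x\<bar> \<le> B * indicator (cball 0 R) x"
    and lim: "(\<lambda>n. LINT x|lborel. indicator (cball 0 R) x * \<bar>F n x - G x\<bar>) \<longlonglongrightarrow> 0"
  shows "(\<lambda>n. LINT x|lborel. F n x * w x) \<longlonglongrightarrow> (LINT x|lborel. G x * w x)"
proof (rule LIM_zero_cancel, rule Lim_null_comparison)
  have IF: "integrable lborel (\<lambda>x. F n x * w x)" for n by (rule locally_integrable_mult[OF Fn w])
  have IG: "integrable lborel (\<lambda>x. G x * w x)" by (rule locally_integrable_mult[OF G w])
  show "\<forall>\<^sub>F n in sequentially. norm ((LINT x|lborel. F n x * w x) - (LINT x|lborel. G x * w x))
      \<le> B * (LINT x|lborel. indicator (cball 0 R) x * \<bar>F n x - G x\<bar>)"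
  proof (rule always_eventually, rule allI)
    fix n
    have "norm ((LINT x|lborel. F n x * w x) - (LINT x|lborel. G x * w x))
        = \<bar>LINT x|lborel. F n x * w x - G x * w x\<bar>"
      using IF IG by simp
    also have "\<dots> \<le> (LINT x|lborel. \<bar>F n x * w x - G x * w x\<bar>)"
      by (rule integral_abs_bound)
    also have "\<dots> \<le> (LINT x|lborel. B * (indicator (cball 0 R) x * \<bar>F n x - G x\<bar>))"
    proof (rule integral_mono_AE)
      show "AE x in lborel. \<bar>F n x * w x - G x * w x\<bar> \<le> B * (indicator (cball 0 R) x * \<bar>F n x - G x\<bar>)"
        using w(2)
      proof eventually_elim
        case (elim x)
        have "\<bar>F n x * w x - G x * w x\<bar> = \<bar>F n x - G x\<bar> * \<bar>w x\<bar>"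
          by (simp add: left_diff_distrib[symmetric] abs_mult)
        also have "\<dots> \<le> \<bar>F n x - G x\<bar> * (B * indicator (cball 0 R) x)"
          using elim by (intro mult_left_mono) auto
        finally show ?case by (simp add: mult_ac)
      qed
    qed (use IF IG locally_integrable_abs_diff[OF Fn G] in auto)
    finally show "norm ((LINT x|lborel. F n x * w x) - (LINT x|lborel. G x * w x))
      \<le> B * (LINT x|lborel. indicator (cball 0 R) x * \<bar>F n x - G x\<bar>)" by simp
  qed
  show "(\<lambda>n. B * (LINT x|lborel. indicator (cball 0 R) x * \<bar>F n x - G x\<bar>)) \<longlonglongrightarrow> 0"
    using tendsto_mult[OF tendsto_const lim, of B] by simp
qed

subsection \<open>Product rule for weak derivatives\<close>

lemma Ck_exp: "(\<And>k. Ck k q) \<Longrightarrow> Ck k (\<lambda>x. exp (q x))"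
  using Ck_comp[of "\<lambda>_. exp" q k 0] by (simp add: DERIV_exp)

text \<open>A smooth substitute for the positive part: \<open>soft c t\<close> tends to \<open>t\<close> and its derivative
  \<open>1 - exp (- c * t)\<close> to the indicator of \<open>t > 0\<close>, as \<open>c\<close> tends to infinity, for \<open>t \<ge> 0\<close>.\<close>

definition soft :: "real \<Rightarrow> real \<Rightarrow> real" where
  "soft c t = t + (exp (- c * t) - 1) / c"

lemma soft_has_derivative:
  assumes "c > 0"
  shows "(soft c has_real_derivative 1 - exp (- c * t)) (at t)"
  unfolding soft_def[abs_def] using assms by (auto intro!: derivative_eq_intros simp: field_simps)

text \<open>For nonnegative arguments the slope \<open>1 - exp (- c * t)\<close> lies between 0 and
  1, whereas for negative ones it is unbounded. This is why the mollifications of \<open>h\<close>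
  must stay nonnegative.\<close>

lemma soft_Lipschitz:
  assumes "c > 0" "0 \<le> s" "0 \<le> t"
  shows "\<bar>soft c s - soft c t\<bar> \<le> \<bar>s - t\<bar>"
proof -
  have "norm (soft c s - soft c t) \<le> 1 * norm (s - t)"
  proof (rule field_differentiable_bound[of "{0..}" _ "\<lambda>t. 1 - exp (- c * t)"])
    show "(soft c has_real_derivative 1 - exp (- c * z)) (at z within {0..})" for z
      by (rule has_field_derivative_at_within[OF soft_has_derivative[OF assms(1)]])
  qed (use assms in auto)
  then show ?thesis by simp
qed

lemma measurable_soft[measurable]: "soft c \<in> borel_measurable borel"
  unfolding soft_def[abs_def] by measurable

lemma soft_0: "soft c 0 = 0"
  by (simp add: soft_def)

lemma soft_abs_le:
  assumes "c > 0" "0 \<le> t"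
  shows "\<bar>soft c t\<bar> \<le> \<bar>t\<bar>"
  using soft_Lipschitz[of c t 0] assms by (simp add: soft_0)

lemma Ck_soft:
  assumes "\<And>k. Ck k q"
  shows "Ck k (\<lambda>x. soft c (q x))"
proof -
  have "Ck k (\<lambda>x. q x + (1 / c) * (exp ((- c) * q x) + (- 1)))"
    by (intro Ck_add Ck_mult Ck_const Ck_exp assms)
  then show ?thesis by (simp add: soft_def)
qed

text \<open>With only \<open>h\<close> mollified, \<open>\<psi>\<close> times a smooth function of
  the mollification is a legitimate test function for \<open>f\<close>. In the limit,
  \<open>soft\<close> of the mollifications converges in \<open>L^1\<close> on the ball by the
  Lipschitz bound. The term with the derivative of \<open>h\<close> is harder: there a factor that
  depends nonlinearly on the mollification multiplies a function converging only in
  \<open>L^1\<close>.\<close>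

lemma weak_product_soft:
  fixes f g h k \<psi> :: "real^'d \<Rightarrow> real"
  assumes f: "has_weak_partial_deriv j f g" and h: "has_weak_partial_deriv j h k"
    and h0: "\<And>x. 0 \<le> h x" and \<psi>: "test_function \<psi>" and c: "c > 0"
    and Rf: "AE x in lborel. \<bar>f x * \<psi> x\<bar> \<le> B * indicator (cball 0 R) x"
    and Rf': "AE x in lborel. \<bar>f x * partial_deriv j \<psi> x\<bar> \<le> B * indicator (cball 0 R) x"
    and Rg: "AE x in lborel. \<bar>g x * \<psi> x\<bar> \<le> B * indicator (cball 0 R) x"
  shows "(LINT x|lborel. (1 - exp (- c * h x)) * k x * (f x * \<psi> x))
      + (LINT x|lborel. soft c (h x) * (f x * partial_deriv j \<psi> x))
      = - (LINT x|lborel. soft c (h x) * (g x * \<psi> x))"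
proof -
  note lf = has_weak_partial_derivD(1,2)[OF f] and lh = has_weak_partial_derivD(1,2)[OF h]
  have \<psi>': "test_function (partial_deriv j \<psi>)" by (rule test_function_partial[OF \<psi>])
  have [measurable]: "cball (0::real^'d) R \<in> sets borel" by simp
  define u where "u n = mollify n h" for n
  define v where "v n = mollify n k" for n
  have [measurable]: "f \<in> borel_measurable borel" "g \<in> borel_measurable borel" "h \<in> borel_measurable borel"
    "k \<in> borel_measurable borel" "\<psi> \<in> borel_measurable borel" "partial_deriv j \<psi> \<in> borel_measurable borel"
    by (intro locally_integrable_measurable lf lh measurable_test_function \<psi> \<psi>')+
  have cu: "continuous_on UNIV (u n)" and cv: "continuous_on UNIV (v n)" for n
    unfolding u_def v_def by (intro continuous_mollify lh)+
  have lu: "locally_integrable (u n)" and lv: "locally_integrable (v n)" for n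
    by (intro locally_integrable_continuous cu cv)+
  have [measurable]: "u n \<in> borel_measurable borel" "v n \<in> borel_measurable borel" for n
    by (intro locally_integrable_measurable lu lv)+
  have u0: "0 \<le> u n x" for n x unfolding u_def by (rule mollify_nonneg[OF h0])
  have ulim: "(\<lambda>n. LINT x|lborel. indicator (cball 0 R) x * \<bar>u n x - h x\<bar>) \<longlonglongrightarrow> 0"
    unfolding u_def by (rule mollify_L1_local[OF lh(1)])
  have vlim: "(\<lambda>n. LINT x|lborel. indicator (cball 0 R) x * \<bar>v n x - k x\<bar>) \<longlonglongrightarrow> 0"
    unfolding v_def by (rule mollify_L1_local[OF lh(2)])
  have lsu: "locally_integrable (\<lambda>x. soft c (u n x))" for n
    by (rule locally_integrable_bound[OF lu _ soft_abs_le[OF c u0]]) measurable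
  have lsh: "locally_integrable (\<lambda>x. soft c (h x))"
    by (rule locally_integrable_bound[OF lh(1) _ soft_abs_le[OF c h0]]) measurable
  have e01: "\<bar>1 - exp (- c * t)\<bar> \<le> 1" if "0 \<le> t" for t
    using c that by simp
  have lev: "locally_integrable (\<lambda>x. (1 - exp (- c * u n x)) * v n x)" for n
  proof (rule locally_integrable_bound[OF lv])
    show "\<bar>(1 - exp (- c * u n x)) * v n x\<bar> \<le> \<bar>v n x\<bar>" for x
      using mult_right_mono[OF e01[OF u0], of "\<bar>v n x\<bar>" n x] by (simp add: abs_mult)
  qed measurable
  have lek: "locally_integrable (\<lambda>x. (1 - exp (- c * h x)) * k x)"
  proof (rule locally_integrable_bound[OF lh(2)])
    show "\<bar>(1 - exp (- c * h x)) * k x\<bar> \<le> \<bar>k x\<bar>" for x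
      using mult_right_mono[OF e01[OF h0], of "\<bar>k x\<bar>" x] by (simp add: abs_mult)
  qed measurable

  have approx: "(LINT x|lborel. (1 - exp (- c * u n x)) * v n x * (f x * \<psi> x))
      + (LINT x|lborel. soft c (u n x) * (f x * partial_deriv j \<psi> x))
      = - (LINT x|lborel. soft c (u n x) * (g x * \<psi> x))" for n
  proof -
    have Cu: "Ck m (u n)" for m unfolding u_def by (rule Ck_mollify[OF lh(1)])
    have t: "test_function (\<lambda>x. \<psi> x * soft c (u n x))"
      by (intro test_function_mult \<psi> Ck_soft Cu)
    have pd: "partial_deriv j (\<lambda>x. \<psi> x * soft c (u n x)) x
        = \<psi> x * ((1 - exp (- c * u n x)) * v n x) + partial_deriv j \<psi> x * soft c (u n x)" for x
    proof -
      have "partial_deriv j (\<lambda>x. soft c (u n x)) x = (1 - exp (- c * u n x)) * partial_deriv j (u n) x"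
        by (rule partial_deriv_comp[OF soft_has_derivative[OF c] Ck_differentiable[OF Cu]])
      moreover have "partial_deriv j (\<lambda>x. \<psi> x * soft c (u n x)) x
          = \<psi> x * partial_deriv j (\<lambda>x. soft c (u n x)) x + partial_deriv j \<psi> x * soft c (u n x)"
        by (rule partial_deriv_mult[OF test_function_differentiable[OF \<psi>] Ck_differentiable[OF Ck_soft[OF Cu]]])
      ultimately show ?thesis
        by (simp add: u_def v_def partial_deriv_mollify[OF h])
    qed
    have "integrable lborel (\<lambda>x. (1 - exp (- c * u n x)) * v n x * (f x * \<psi> x))"
      "integrable lborel (\<lambda>x. soft c (u n x) * (f x * partial_deriv j \<psi> x))"
      using locally_integrable_mult[OF lev _ Rf, of n] locally_integrable_mult[OF lsu _ Rf', of n] by auto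
    then have "(LINT x|lborel. (1 - exp (- c * u n x)) * v n x * (f x * \<psi> x))
      + (LINT x|lborel. soft c (u n x) * (f x * partial_deriv j \<psi> x))
      = (LINT x|lborel. (1 - exp (- c * u n x)) * v n x * (f x * \<psi> x) + soft c (u n x) * (f x * partial_deriv j \<psi> x))"
      by simp
    also have "\<dots> = (LINT x|lborel. f x * partial_deriv j (\<lambda>x. \<psi> x * soft c (u n x)) x)"
      by (intro Bochner_Integration.integral_cong refl) (simp add: pd algebra_simps)
    also have "\<dots> = - (LINT x|lborel. g x * (\<psi> x * soft c (u n x)))"
      by (rule has_weak_partial_derivD(3)[OF f t])
    finally show ?thesis by (simp add: mult_ac)
  qed

  \<comment> \<open>Convergence in \<open>L^1\<close> yields almost everywhere convergence along a
    subsequence, which is what the exponential factor needs; all limits below are taken along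
    it.\<close>
  have "\<exists>r. strict_mono r \<and> (AE x in lborel. (\<lambda>n. indicator (cball 0 R) x * (u (r n) x - h x)) \<longlonglongrightarrow> 0)"
  proof (rule tendsto_L1_AE_subseq)
    show "integrable lborel (\<lambda>x. indicator (cball 0 R) x * (u n x - h x))" for n
      using Bochner_Integration.integrable_diff[OF locally_integrable_cball[OF lu] locally_integrable_cball[OF lh(1)], of R n R]
      by (simp add: right_diff_distrib)
    show "(\<lambda>n. LINT x|lborel. norm (indicator (cball 0 R) x * (u n x - h x))) \<longlonglongrightarrow> 0"
      using ulim by (simp add: abs_mult)
  qed
  then obtain r where r: "strict_mono r"
    and ae: "AE x in lborel. (\<lambda>n. indicator (cball 0 R) x * (u (r n) x - h x)) \<longlonglongrightarrow> 0" by blast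

  have slim: "(\<lambda>n. LINT x|lborel. indicator (cball 0 R) x * \<bar>soft c (u (r n) x) - soft c (h x)\<bar>) \<longlonglongrightarrow> 0"
  proof (rule Lim_null_comparison)
    show "(\<lambda>n. LINT x|lborel. indicator (cball 0 R) x * \<bar>u (r n) x - h x\<bar>) \<longlonglongrightarrow> 0"
      using LIMSEQ_subseq_LIMSEQ[OF ulim r] by (simp add: o_def)
    show "\<forall>\<^sub>F n in sequentially. norm (LINT x|lborel. indicator (cball 0 R) x * \<bar>soft c (u (r n) x) - soft c (h x)\<bar>)
      \<le> (LINT x|lborel. indicator (cball 0 R) x * \<bar>u (r n) x - h x\<bar>)"
    proof (rule always_eventually, rule allI)
      fix n
      have "(LINT x|lborel. indicator (cball 0 R) x * \<bar>soft c (u (r n) x) - soft c (h x)\<bar>)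
        \<le> (LINT x|lborel. indicator (cball 0 R) x * \<bar>u (r n) x - h x\<bar>)"
        by (intro Bochner_Integration.integral_mono locally_integrable_abs_diff lsu lsh lu lh mult_left_mono
              soft_Lipschitz c u0 h0) auto
      then show "norm (LINT x|lborel. indicator (cball 0 R) x * \<bar>soft c (u (r n) x) - soft c (h x)\<bar>)
        \<le> (LINT x|lborel. indicator (cball 0 R) x * \<bar>u (r n) x - h x\<bar>)"
        by (simp add: integral_nonneg_AE)
    qed
  qed

  have elim: "(\<lambda>n. LINT x|lborel. indicator (cball 0 R) x *
      \<bar>(1 - exp (- c * u (r n) x)) * v (r n) x - (1 - exp (- c * h x)) * k x\<bar>) \<longlonglongrightarrow> 0"
  proof (rule Lim_null_comparison)
    \<comment> \<open>With \<open>a_n\<close> and \<open>a\<close> for the exponential factors,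
      \<open>a_n * v_n - a * k = a_n * (v_n - k) + (a_n - a) * k\<close>. The first part is small
      because \<open>a_n\<close> is between 0 and 1; the size of the second is \<open>?d\<close>,
      dominated by the absolute value of \<open>k\<close> on the ball.\<close>
    let ?d = "\<lambda>n x. indicator (cball 0 R) x * (\<bar>exp (- c * u (r n) x) - exp (- c * h x)\<bar> * \<bar>k x\<bar>)"
    have dle: "?d n x \<le> indicator (cball 0 R) x * \<bar>k x\<bar>" for n x
    proof -
      have "\<bar>exp (- c * u (r n) x) - exp (- c * h x)\<bar> \<le> 1"
        using e01[OF u0, of "r n" x] e01[OF h0, of x] exp_gt_zero[of "- c * u (r n) x"] exp_gt_zero[of "- c * h x"]
        by (smt (verit) c h0 u0 exp_le_one_iff mult_nonneg_nonneg mult_minus_left)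
      then show ?thesis by (auto simp: indicator_def intro!: mult_left_le_one_le)
    qed
    have Ik: "integrable lborel (\<lambda>x. indicator (cball 0 R) x * \<bar>k x\<bar>)"
      using integrable_abs[OF locally_integrable_cball[OF lh(2), of R]] by (simp add: abs_mult)
    have Id: "integrable lborel (?d n)" for n
    proof (rule Bochner_Integration.integrable_bound[OF Ik])
      show "AE x in lborel. norm (?d n x) \<le> norm (indicator (cball 0 R) x * \<bar>k x\<bar>)"
        using dle by (intro AE_I2) simp
    qed measurable
    have "(\<lambda>n. LINT x|lborel. ?d n x) \<longlonglongrightarrow> (LINT x::real^'d|lborel. (0::real))"
    proof (rule integral_dominated_convergence[where w="\<lambda>x. indicator (cball 0 R) x * \<bar>k x\<bar>"])
      show "AE x in lborel. (\<lambda>n. ?d n x) \<longlonglongrightarrow> 0"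
        using ae
      proof eventually_elim
        case (elim x)
        show ?case
        proof (cases "x \<in> cball 0 R")
          case True
          with elim have "(\<lambda>n. u (r n) x) \<longlonglongrightarrow> h x" by (simp add: LIM_zero_iff)
          then have "(\<lambda>n. 1 * (\<bar>exp (- c * u (r n) x) - exp (- c * h x)\<bar> * \<bar>k x\<bar>))
              \<longlonglongrightarrow> 1 * (\<bar>exp (- c * h x) - exp (- c * h x)\<bar> * \<bar>k x\<bar>)"
            by (intro tendsto_intros)
          then show ?thesis using True by simp
        qed simp
      qed
      show "AE x in lborel. norm (?d n x) \<le> indicator (cball 0 R) x * \<bar>k x\<bar>" for n
        using dle by simp
    qed (use Ik Id in auto)
    then have dlim: "(\<lambda>n. LINT x|lborel. ?d n x) \<longlonglongrightarrow> 0" by simp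
    show "(\<lambda>n. (LINT x|lborel. indicator (cball 0 R) x * \<bar>v (r n) x - k x\<bar>) + (LINT x|lborel. ?d n x)) \<longlonglongrightarrow> 0"
      using tendsto_add[OF LIMSEQ_subseq_LIMSEQ[OF vlim r] dlim] by (simp add: o_def)
    show "\<forall>\<^sub>F n in sequentially. norm (LINT x|lborel. indicator (cball 0 R) x *
        \<bar>(1 - exp (- c * u (r n) x)) * v (r n) x - (1 - exp (- c * h x)) * k x\<bar>)
      \<le> (LINT x|lborel. indicator (cball 0 R) x * \<bar>v (r n) x - k x\<bar>) + (LINT x|lborel. ?d n x)"
    proof (rule always_eventually, rule allI)
      fix n
      let ?e = "\<lambda>x. indicator (cball 0 R) x * \<bar>(1 - exp (- c * u (r n) x)) * v (r n) x - (1 - exp (- c * h x)) * k x\<bar>"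
      have "(LINT x|lborel. ?e x) \<le> (LINT x|lborel. indicator (cball 0 R) x * \<bar>v (r n) x - k x\<bar> + ?d n x)"
      proof (rule Bochner_Integration.integral_mono)
        fix x
        have "(1 - exp (- c * u (r n) x)) * v (r n) x - (1 - exp (- c * h x)) * k x
          = (1 - exp (- c * u (r n) x)) * (v (r n) x - k x) + (exp (- c * h x) - exp (- c * u (r n) x)) * k x"
          by (simp add: algebra_simps)
        also have "\<bar>\<dots>\<bar> \<le> \<bar>1 - exp (- c * u (r n) x)\<bar> * \<bar>v (r n) x - k x\<bar>
            + \<bar>exp (- c * u (r n) x) - exp (- c * h x)\<bar> * \<bar>k x\<bar>"
          by (rule order_trans[OF abs_triangle_ineq]) (simp add: abs_mult abs_minus_commute)
        also have "\<dots> \<le> \<bar>v (r n) x - k x\<bar> + \<bar>exp (- c * u (r n) x) - exp (- c * h x)\<bar> * \<bar>k x\<bar>"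
          using mult_right_mono[OF e01[OF u0], of "\<bar>v (r n) x - k x\<bar>" "r n" x] by simp
        finally show "?e x \<le> indicator (cball 0 R) x * \<bar>v (r n) x - k x\<bar> + ?d n x"
          by (auto simp: indicator_def)
      qed (intro Bochner_Integration.integrable_add Id locally_integrable_abs_diff lev lek lv lh)+
      also have "\<dots> = (LINT x|lborel. indicator (cball 0 R) x * \<bar>v (r n) x - k x\<bar>) + (LINT x|lborel. ?d n x)"
        by (intro Bochner_Integration.integral_add Id locally_integrable_abs_diff lv lh)
      finally show "norm (LINT x|lborel. ?e x)
        \<le> (LINT x|lborel. indicator (cball 0 R) x * \<bar>v (r n) x - k x\<bar>) + (LINT x|lborel. ?d n x)"
        by (simp add: integral_nonneg_AE)
    qed
  qed

  have 1: "(\<lambda>n. LINT x|lborel. (1 - exp (- c * u (r n) x)) * v (r n) x * (f x * \<psi> x))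
      \<longlonglongrightarrow> (LINT x|lborel. (1 - exp (- c * h x)) * k x * (f x * \<psi> x))"
    by (rule L1_local_weighted_limit[OF lev lek _ Rf elim]) measurable
  have 2: "(\<lambda>n. LINT x|lborel. soft c (u (r n) x) * (f x * partial_deriv j \<psi> x))
      \<longlonglongrightarrow> (LINT x|lborel. soft c (h x) * (f x * partial_deriv j \<psi> x))"
    by (rule L1_local_weighted_limit[OF lsu lsh _ Rf' slim]) measurable
  have 3: "(\<lambda>n. LINT x|lborel. soft c (u (r n) x) * (g x * \<psi> x))
      \<longlonglongrightarrow> (LINT x|lborel. soft c (h x) * (g x * \<psi> x))"
    by (rule L1_local_weighted_limit[OF lsu lsh _ Rg slim]) measurable
  show ?thesis
    by (rule LIMSEQ_unique[OF tendsto_add[OF 1 2]]) (use tendsto_minus[OF 3] approx in simp)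
qed

text \<open>The derivative of \<open>h\<close> enters only through \<open>{h > 0}\<close>, although nothing is assumed
  about it on \<open>{h = 0}\<close>: testing with functions of \<open>h\<close> that are flat at \<open>0\<close> removes that set.\<close>

lemma weak_product_rule:
  fixes f g h k \<psi> :: "real^'d \<Rightarrow> real"
  assumes f: "has_weak_partial_deriv j f g" and h: "has_weak_partial_deriv j h k"
    and h0: "\<And>x. 0 \<le> h x" and \<psi>: "test_function \<psi>"
    and bf: "AE x in lborel. \<bar>f x\<bar> \<le> K * (1 + norm x)" and bg: "AE x in lborel. \<bar>g x\<bar> \<le> C"
  shows "integrable lborel (\<lambda>x. f x * \<psi> x * (if 0 < h x then k x else 0))"
    and "integrable lborel (\<lambda>x. g x * \<psi> x * h x)"
    and "(LINT x|lborel. f x * \<psi> x * (if 0 < h x then k x else 0)) + (LINT x|lborel. g x * \<psi> x * h x)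
      = - (LINT x|lborel. f x * partial_deriv j \<psi> x * h x)"
proof -
  note lf = has_weak_partial_derivD(1,2)[OF f] and lh = has_weak_partial_derivD(1,2)[OF h]
  have \<psi>': "test_function (partial_deriv j \<psi>)" by (rule test_function_partial[OF \<psi>])
  have [measurable]: "f \<in> borel_measurable borel" "g \<in> borel_measurable borel" "h \<in> borel_measurable borel"
    "k \<in> borel_measurable borel" "\<psi> \<in> borel_measurable borel" "partial_deriv j \<psi> \<in> borel_measurable borel"
    by (intro locally_integrable_measurable lf lh measurable_test_function \<psi> \<psi>')+
  obtain R where R: "R > 0" "\<And>x. norm x > R \<Longrightarrow> \<psi> x = 0" using test_function_support[OF \<psi>] by blast
  have R': "partial_deriv j \<psi> x = 0" if "norm x > R" for x
    by (rule partial_deriv_eq_0_outside[OF R(2) that])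
  obtain S where S: "S > 0" "\<And>x. \<bar>\<psi> x\<bar> \<le> S" using test_function_bounded[OF \<psi>] by blast
  obtain S' where S': "S' > 0" "\<And>x. \<bar>partial_deriv j \<psi> x\<bar> \<le> S'" using test_function_bounded[OF \<psi>'] by blast
  \<comment> \<open>One constant for all three weights: a bound for \<open>f\<close> on the ball and
    for \<open>g\<close>, times a bound for \<open>\<psi>\<close> and for its derivative.\<close>
  define B where "B = (\<bar>K\<bar> * (1 + R) + \<bar>C\<bar>) * (S + S')"
  have B: "a * s \<le> B" if "a \<le> \<bar>K\<bar> * (1 + R) + \<bar>C\<bar>" "s \<le> S + S'" "0 \<le> s" for a s
    unfolding B_def using that R(1) by (intro mult_mono) auto
  have fb: "AE x in lborel. norm x \<le> R \<longrightarrow> \<bar>f x\<bar> \<le> \<bar>K\<bar> * (1 + R) + \<bar>C\<bar>"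
    using bf
  proof eventually_elim
    case (elim x)
    have "K * (1 + norm x) \<le> \<bar>K\<bar> * (1 + R)" if "norm x \<le> R"
      using that by (intro mult_mono) auto
    with elim show ?case by auto
  qed
  have gb: "AE x in lborel. \<bar>g x\<bar> \<le> \<bar>K\<bar> * (1 + R) + \<bar>C\<bar>"
  proof -
    have "0 \<le> \<bar>K\<bar> * (1 + R)" using R(1) by simp
    then have "C \<le> \<bar>K\<bar> * (1 + R) + \<bar>C\<bar>" by linarith
    then show ?thesis using bg by (auto elim!: eventually_mono)
  qed
  have S_le: "\<bar>\<psi> x\<bar> \<le> S + S'" "\<bar>partial_deriv j \<psi> x\<bar> \<le> S + S'" for x
    using S(1) S(2)[of x] S'(1) S'(2)[of x] by linarith+
  have Rf: "AE x in lborel. \<bar>f x * \<psi> x\<bar> \<le> B * indicator (cball 0 R) x"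
    using fb by eventually_elim (use R(2) in \<open>auto simp: abs_mult indicator_def intro!: B S_le\<close>)
  have Rf': "AE x in lborel. \<bar>f x * partial_deriv j \<psi> x\<bar> \<le> B * indicator (cball 0 R) x"
    using fb by eventually_elim (use R' in \<open>auto simp: abs_mult indicator_def intro!: B S_le\<close>)
  have Rg: "AE x in lborel. \<bar>g x * \<psi> x\<bar> \<le> B * indicator (cball 0 R) x"
    using gb by eventually_elim (use R(2) in \<open>auto simp: abs_mult indicator_def intro!: B S_le\<close>)
  have I1: "integrable lborel (\<lambda>x. k x * (f x * \<psi> x))"
    by (rule locally_integrable_mult[OF lh(2) _ Rf]) measurable
  have I2: "integrable lborel (\<lambda>x. h x * (f x * partial_deriv j \<psi> x))"
    by (rule locally_integrable_mult[OF lh(1) _ Rf']) measurable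
  have I3: "integrable lborel (\<lambda>x. h x * (g x * \<psi> x))"
    by (rule locally_integrable_mult[OF lh(1) _ Rg]) measurable
  show "integrable lborel (\<lambda>x. f x * \<psi> x * (if 0 < h x then k x else 0))"
    by (rule Bochner_Integration.integrable_bound[OF I1]) (auto simp: mult_ac)
  show "integrable lborel (\<lambda>x. g x * \<psi> x * h x)"
    using I3 by (simp add: mult_ac)

  define c :: "nat \<Rightarrow> real" where "c n = real (Suc n)" for n
  have c: "c n > 0" for n by (simp add: c_def)
  have ctop: "filterlim c at_top sequentially"
    unfolding c_def[abs_def] by (rule filterlim_compose[OF filterlim_real_sequentially filterlim_Suc])
  have exp_lim: "(\<lambda>n. 1 - exp (- c n * t)) \<longlonglongrightarrow> (if 0 < t then 1 else 0)" if "0 \<le> t" for t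
  proof (cases "t = 0")
    case False
    then have "filterlim (\<lambda>n. t * c n) at_top sequentially"
      using that by (intro filterlim_tendsto_pos_mult_at_top[OF tendsto_const _ ctop]) auto
    then have "filterlim (\<lambda>n. - (t * c n)) at_bot sequentially"
      by (simp add: filterlim_uminus_at_bot)
    then have "(\<lambda>n. exp (- (t * c n))) \<longlonglongrightarrow> 0"
      by (rule filterlim_compose[OF exp_at_bot])
    then have "(\<lambda>n. 1 - exp (- (t * c n))) \<longlonglongrightarrow> 1 - 0" by (intro tendsto_intros)
    then show ?thesis using that False by (simp add: mult.commute)
  qed simp
  have soft_lim: "(\<lambda>n. soft (c n) t) \<longlonglongrightarrow> t" if "0 \<le> t" for t
  proof -
    have "(\<lambda>n. 1 / c n) \<longlonglongrightarrow> 0"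
      using LIMSEQ_inverse_real_of_nat by (simp add: c_def inverse_eq_divide)
    from tendsto_mult[OF exp_lim[OF that] this]
    have "(\<lambda>n. t - (1 - exp (- c n * t)) * (1 / c n)) \<longlonglongrightarrow> t - 0"
      by (intro tendsto_intros) simp
    moreover have "soft (c n) t = t - (1 - exp (- c n * t)) * (1 / c n)" for n
      by (simp add: soft_def diff_divide_distrib)
    ultimately show ?thesis by simp
  qed
  have D: "(\<lambda>n. LINT x|lborel. soft (c n) (h x) * w x) \<longlonglongrightarrow> (LINT x|lborel. h x * w x)"
    if I: "integrable lborel (\<lambda>x. h x * w x)" and [measurable]: "w \<in> borel_measurable borel" for w
  proof (rule integral_dominated_convergence[where w="\<lambda>x. \<bar>h x * w x\<bar>"])
    show "(\<lambda>x. soft (c n) (h x) * w x) \<in> borel_measurable lborel" for n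
      unfolding soft_def by measurable
    show "AE x in lborel. (\<lambda>n. soft (c n) (h x) * w x) \<longlonglongrightarrow> h x * w x"
      using soft_lim[OF h0] by (intro AE_I2 tendsto_mult tendsto_const)
    show "AE x in lborel. norm (soft (c n) (h x) * w x) \<le> \<bar>h x * w x\<bar>" for n
      using mult_right_mono[OF soft_abs_le[OF c h0], of "\<bar>w x\<bar>" n x for x] by (intro AE_I2) (simp add: abs_mult)
  qed (use I in auto)
  have 1: "(\<lambda>n. LINT x|lborel. (1 - exp (- c n * h x)) * k x * (f x * \<psi> x))
      \<longlonglongrightarrow> (LINT x|lborel. (if 0 < h x then 1 else 0) * k x * (f x * \<psi> x))"
  proof (rule integral_dominated_convergence[where w="\<lambda>x. \<bar>k x * (f x * \<psi> x)\<bar>"])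
    show "AE x in lborel. (\<lambda>n. (1 - exp (- c n * h x)) * k x * (f x * \<psi> x))
        \<longlonglongrightarrow> (if 0 < h x then 1 else 0) * k x * (f x * \<psi> x)"
      using exp_lim[OF h0] by (intro AE_I2 tendsto_mult tendsto_const)
    have "\<bar>1 - exp (- c n * h x)\<bar> \<le> 1" for n x
      using c[of n] h0[of x] by simp
    then show "AE x in lborel. norm ((1 - exp (- c n * h x)) * k x * (f x * \<psi> x)) \<le> \<bar>k x * (f x * \<psi> x)\<bar>" for n
      using mult_right_mono[of "\<bar>1 - exp (- c n * h x)\<bar>" 1 "\<bar>k x * (f x * \<psi> x)\<bar>" for x]
      by (intro AE_I2) (simp add: abs_mult mult.assoc)
  qed (use I1 in auto)
  have 2: "(LINT x|lborel. (if 0 < h x then 1 else 0) * k x * (f x * \<psi> x)) + (LINT x|lborel. h x * (f x * partial_deriv j \<psi> x))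
     = - (LINT x|lborel. h x * (g x * \<psi> x))"
  proof (rule LIMSEQ_unique[OF tendsto_add[OF 1 D[OF I2]]])
    show "(\<lambda>n. (LINT x|lborel. (1 - exp (- c n * h x)) * k x * (f x * \<psi> x))
        + (LINT x|lborel. soft (c n) (h x) * (f x * partial_deriv j \<psi> x))) \<longlonglongrightarrow> - (LINT x|lborel. h x * (g x * \<psi> x))"
      unfolding weak_product_soft[OF f h h0 \<psi> c Rf Rf' Rg] by (intro tendsto_minus D I3) measurable
  qed measurable
  have "(LINT x|lborel. f x * \<psi> x * (if 0 < h x then k x else 0)) = (LINT x|lborel. (if 0 < h x then 1 else 0) * k x * (f x * \<psi> x))"
    by (intro Bochner_Integration.integral_cong) auto
  with 2 show "(LINT x|lborel. f x * \<psi> x * (if 0 < h x then k x else 0)) + (LINT x|lborel. g x * \<psi> x * h x)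
      = - (LINT x|lborel. f x * partial_deriv j \<psi> x * h x)"
    by (simp add: mult_ac)
qed

subsection \<open>Moments and divergence of an exponential family\<close>

text \<open>The norm is at most the sum of the absolute coordinates, so some coordinate has absolute
  value at least \<open>norm y / CARD('d)\<close>. Each summand is the exponential of a linear form
  and can therefore be absorbed into a natural parameter.\<close>

lemma exp_norm_le_sum:
  fixes y :: "real^'d"
  assumes "0 \<le> c"
  shows "exp (c * norm y) \<le> (\<Sum>i\<in>UNIV. exp (c * CARD('d) * y $ i) + exp (- (c * CARD('d) * y $ i)))"
proof -
  have "\<exists>i. norm y \<le> CARD('d) * \<bar>y $ i\<bar>"
  proof (rule ccontr)
    assume "\<nexists>i. norm y \<le> CARD('d) * \<bar>y $ i\<bar>"
    then have "\<bar>y $ i\<bar> < norm y / CARD('d)" for i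
      by (simp add: not_le field_simps)
    then have "(\<Sum>i\<in>UNIV. \<bar>y $ i\<bar>) < (\<Sum>i\<in>(UNIV::'d set). norm y / CARD('d))"
      by (intro sum_strict_mono) auto
    then show False using norm_le_l1_cart[of y] by simp
  qed
  then obtain i where i: "norm y \<le> CARD('d) * \<bar>y $ i\<bar>" by blast
  have "exp (c * norm y) \<le> exp (c * (CARD('d) * \<bar>y $ i\<bar>))"
    using mult_left_mono[OF i assms] by simp
  also have "\<dots> \<le> exp (c * CARD('d) * y $ i) + exp (- (c * CARD('d) * y $ i))"
    by (cases "0 \<le> y $ i") (auto simp: mult.assoc)
  also have "\<dots> \<le> (\<Sum>i\<in>UNIV. exp (c * CARD('d) * y $ i) + exp (- (c * CARD('d) * y $ i)))"
    by (rule member_le_sum) auto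
  finally show ?thesis .
qed

section \<open>Moments, log-partition function and divergences of a fixed family\<close>

context
  fixes h A :: "real^'d \<Rightarrow> real"
  assumes nef: "natural_exponential_family h A"
begin

lemma nef_base_measurable[measurable]: "h \<in> borel_measurable borel"
  and nef_base_nonneg: "0 \<le> h y"
  using nef by (auto simp: natural_exponential_family_def)

lemma nef_density_measurable[measurable]: "nef_density h A \<theta> \<in> borel_measurable borel"
  unfolding nef_density_def[abs_def] by measurable

lemma nef_density_nonneg: "0 \<le> nef_density h A \<theta> y"
  by (simp add: nef_density_def nef_base_nonneg)

lemma nn_integral_nef_density: "(\<integral>\<^sup>+y. ennreal (nef_density h A \<theta> y) \<partial>lborel) = 1"
proof -
  interpret prob_space "nef h A \<theta>"
    using nef by (simp add: natural_exponential_family_def)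
  show ?thesis
    using emeasure_space_1 by (simp add: nef_def emeasure_density)
qed

lemma integrable_nef_density: "integrable lborel (nef_density h A \<theta>)"
  by (rule integrableI_nonneg) (simp_all add: nn_integral_nef_density nef_density_nonneg)

lemma integral_nef_density: "(LINT y|lborel. nef_density h A \<theta> y) = 1"
  by (simp add: integral_eq_nn_integral nef_density_nonneg nn_integral_nef_density)

lemma nef_weight_eq: "h y * exp (y \<bullet> \<theta>) = exp (A \<theta>) * nef_density h A \<theta> y"
  by (simp add: nef_density_def exp_diff)

text \<open>Multiplication by \<open>exp (s * y $ i)\<close> moves the natural parameter by
  \<open>s\<close> along the axis \<open>i\<close>, and every parameter is admissible; a finite sum
  of such tilts dominates the exponential of the norm.\<close>

lemma integrable_nef_exp_norm:
  assumes "0 \<le> c"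
  shows "integrable lborel (\<lambda>y. h y * exp (y \<bullet> \<theta>) * exp (c * norm y))"
proof (rule Bochner_Integration.integrable_bound)
  let ?e = "\<lambda>i y. c * CARD('d) * (y::real^'d) $ i"
  have I: "integrable lborel (\<lambda>y. h y * exp (y \<bullet> \<theta>))" for \<theta>
    unfolding nef_weight_eq using integrable_nef_density by simp
  have eq: "h y * exp (y \<bullet> \<theta>) * exp (s * y $ i) = h y * exp (y \<bullet> (\<theta> + s *\<^sub>R axis i 1))" for y i s
    by (simp add: inner_add_right inner_axis exp_add mult.assoc)
  have "integrable lborel (\<lambda>y. h y * exp (y \<bullet> \<theta>) * exp (s * y $ i))" for i s
    unfolding eq by (rule I)
  from this[of "c * CARD('d)"] this[of "- (c * CARD('d))"]
  show "integrable lborel (\<lambda>y. \<Sum>i\<in>UNIV. h y * exp (y \<bullet> \<theta>) * exp (?e i y) + h y * exp (y \<bullet> \<theta>) * exp (- ?e i y))"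
    by auto
  have le: "h y * exp (y \<bullet> \<theta>) * exp (c * norm y)
      \<le> (\<Sum>i\<in>UNIV. h y * exp (y \<bullet> \<theta>) * exp (?e i y) + h y * exp (y \<bullet> \<theta>) * exp (- ?e i y))" for y
    using mult_left_mono[OF exp_norm_le_sum[OF assms, of y], of "h y * exp (y \<bullet> \<theta>)"]
    by (simp add: nef_base_nonneg sum_distrib_left distrib_left)
  show "AE y in lborel. norm (h y * exp (y \<bullet> \<theta>) * exp (c * norm y))
      \<le> norm (\<Sum>i\<in>UNIV. h y * exp (y \<bullet> \<theta>) * exp (?e i y) + h y * exp (y \<bullet> \<theta>) * exp (- ?e i y))"
  proof (rule AE_I2)
    fix y
    have "norm (h y * exp (y \<bullet> \<theta>) * exp (c * norm y)) = h y * exp (y \<bullet> \<theta>) * exp (c * norm y)"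
      by (simp add: nef_base_nonneg)
    then show "norm (h y * exp (y \<bullet> \<theta>) * exp (c * norm y))
      \<le> norm (\<Sum>i\<in>UNIV. h y * exp (y \<bullet> \<theta>) * exp (?e i y) + h y * exp (y \<bullet> \<theta>) * exp (- ?e i y))"
      using le[of y] by (simp only: real_norm_def)
  qed
qed measurable

lemma integrable_nef_norm_exp_norm:
  "integrable lborel (\<lambda>y. h y * exp (y \<bullet> \<theta>) * (norm y * exp (norm y)))"
proof (rule Bochner_Integration.integrable_bound[OF integrable_nef_exp_norm[of 2 \<theta>]])
  have "norm y * exp (norm y) \<le> exp (2 * norm y)" for y :: "real^'d"
  proof -
    have "norm y * exp (norm y) \<le> exp (norm y) * exp (norm y)"
      using less_imp_le[OF exp_gt_self] by (intro mult_right_mono) auto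
    then show ?thesis by (simp add: mult_exp_exp)
  qed
  then show "AE y in lborel. norm (h y * exp (y \<bullet> \<theta>) * (norm y * exp (norm y))) \<le> norm (h y * exp (y \<bullet> \<theta>) * exp (2 * norm y))"
    by (intro AE_I2) (simp add: abs_mult nef_base_nonneg mult_left_mono)
qed (auto)

lemma integrable_nef_norm:
  "integrable lborel (\<lambda>y. h y * exp (y \<bullet> \<theta>) * norm y)"
proof (rule Bochner_Integration.integrable_bound[OF integrable_nef_norm_exp_norm[of \<theta>]])
  have "norm y \<le> norm y * exp (norm y)" for y :: "real^'d"
    using mult_left_mono[of 1 "exp (norm y)" "norm y"] by simp
  then show "AE y in lborel. norm (h y * exp (y \<bullet> \<theta>) * norm y) \<le> norm (h y * exp (y \<bullet> \<theta>) * (norm y * exp (norm y)))"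
    by (intro AE_I2) (simp add: abs_mult nef_base_nonneg mult_left_mono)
qed (auto)

lemma integrable_nef_id: "integrable lborel (\<lambda>y. nef_density h A \<theta> y *\<^sub>R y)"
proof (rule Bochner_Integration.integrable_bound[OF integrable_mult_right[OF integrable_nef_norm[of \<theta>], of "exp (- A \<theta>)"]])
  show "AE y in lborel. norm (nef_density h A \<theta> y *\<^sub>R y) \<le> norm (exp (- A \<theta>) * (h y * exp (y \<bullet> \<theta>) * norm y))"
    by (simp add: nef_density_def abs_mult nef_base_nonneg exp_diff exp_minus field_simps)
qed (auto)

definition nef_mean :: "real^'d \<Rightarrow> real^'d" where
  "nef_mean \<theta> = (LINT y|lborel. nef_density h A \<theta> y *\<^sub>R y)"

text \<open>As the densities have mass 1, \<open>exp (A \<theta>)\<close> is the integral of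
  \<open>h y * exp (y \<bullet> \<theta>)\<close>. That integral is differentiated under the
  integral sign, and the logarithm is taken afterwards.\<close>

lemma GDERIV_log_partition: "GDERIV A \<theta> :> nef_mean \<theta>"
proof -
  have "((\<lambda>\<theta>. LINT y|lborel. h y * exp (y \<bullet> \<theta>)) has_derivative
      (\<lambda>v. LINT y|lborel. h y * (exp (y \<bullet> \<theta>) * (y \<bullet> v)))) (at \<theta>)"
  proof (rule has_derivative_integral[where r=1 and G="\<lambda>y. h y * exp (y \<bullet> \<theta>) * (norm y * exp (norm y))"
        and F'="\<lambda>\<theta> y v. h y * (exp (y \<bullet> \<theta>) * (y \<bullet> v))"])
    fix z y v :: "real^'d" assume z: "z \<in> ball \<theta> 1"
    show "((\<lambda>z. h y * exp (y \<bullet> z)) has_derivative (\<lambda>v. h y * (exp (y \<bullet> z) * (y \<bullet> v)))) (at z)"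
      by (auto intro!: derivative_eq_intros)
    \<comment> \<open>On the unit ball around \<open>\<theta>\<close> the exponent grows by at most
      \<open>norm y\<close>, the source of \<open>exp (norm y)\<close> in the dominating
      function.\<close>
    have "y \<bullet> z - y \<bullet> \<theta> = y \<bullet> (z - \<theta>)" by (simp add: inner_diff_right)
    also have "\<dots> \<le> norm y * norm (z - \<theta>)" by (rule norm_cauchy_schwarz)
    also have "\<dots> \<le> norm y * 1" using z by (intro mult_left_mono) (auto simp: dist_norm norm_minus_commute)
    finally have "exp (y \<bullet> z) \<le> exp (y \<bullet> \<theta> + norm y)" by simp
    then have "exp (y \<bullet> z) * \<bar>y \<bullet> v\<bar> \<le> exp (y \<bullet> \<theta> + norm y) * (norm y * norm v)"
      by (intro mult_mono Cauchy_Schwarz_ineq2) auto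
    from mult_left_mono[OF this nef_base_nonneg[of y]]
    show "\<bar>h y * (exp (y \<bullet> z) * (y \<bullet> v))\<bar> \<le> h y * exp (y \<bullet> \<theta>) * (norm y * exp (norm y)) * norm v"
      by (simp add: abs_mult nef_base_nonneg exp_add mult_ac)
  next
    show "integrable lborel (\<lambda>y. h y * exp (y \<bullet> z))" for z
      unfolding nef_weight_eq using integrable_nef_density by simp
    show "integrable lborel (\<lambda>y. h y * exp (y \<bullet> \<theta>) * (norm y * exp (norm y)))"
      by (rule integrable_nef_norm_exp_norm)
  qed (auto simp: nef_base_nonneg)
  moreover have "(LINT y|lborel. h y * exp (y \<bullet> \<theta>)) = exp (A \<theta>)" for \<theta>
    by (simp add: nef_weight_eq integral_nef_density)
  moreover have "(LINT y|lborel. h y * (exp (y \<bullet> \<theta>) * (y \<bullet> v))) = exp (A \<theta>) * (v \<bullet> nef_mean \<theta>)" for v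
  proof -
    have "(LINT y|lborel. h y * (exp (y \<bullet> \<theta>) * (y \<bullet> v))) = (LINT y|lborel. exp (A \<theta>) * ((nef_density h A \<theta> y *\<^sub>R y) \<bullet> v))"
      by (intro Bochner_Integration.integral_cong refl) (simp add: nef_weight_eq mult.assoc[symmetric])
    also have "\<dots> = exp (A \<theta>) * (nef_mean \<theta> \<bullet> v)"
      using integrable_nef_id by (simp add: nef_mean_def del: inner_scaleR_left)
    finally show ?thesis by (simp add: inner_commute)
  qed
  ultimately have E: "((\<lambda>\<theta>. exp (A \<theta>)) has_derivative (\<lambda>v. exp (A \<theta>) * (v \<bullet> nef_mean \<theta>))) (at \<theta>)"
    by simp
  have "((\<lambda>\<theta>. ln (exp (A \<theta>))) has_derivative (\<lambda>v. v \<bullet> nef_mean \<theta>)) (at \<theta>)"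
    by (rule has_derivative_eq_rhs[OF has_derivative_ln[OF exp_gt_zero E]]) (auto simp: fun_eq_iff)
  then show ?thesis by (simp add: gderiv_def)
qed

lemma gradient_log_partition: "gradient A \<theta> = nef_mean \<theta>"
  unfolding gradient_def
proof (rule the_equality)
  show "GDERIV A \<theta> :> nef_mean \<theta>" by (rule GDERIV_log_partition)
  fix D assume "GDERIV A \<theta> :> D"
  then have "(\<lambda>v. v \<bullet> D) = (\<lambda>v. v \<bullet> nef_mean \<theta>)"
    using GDERIV_log_partition[of \<theta>] unfolding gderiv_def by (rule has_derivative_unique)
  then have "\<forall>v. v \<bullet> D = v \<bullet> nef_mean \<theta>" by (simp add: fun_eq_iff)
  then show "D = nef_mean \<theta>" by (simp add: vector_eq_ldot)
qed

text \<open>The base function cancels in the likelihood ratio, whose logarithm is thus affine in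
  \<open>y\<close>. Where \<open>h y = 0\<close> the density factor makes both sides 0.\<close>

lemma nef_KL_integrand:
  "nef_density h A \<theta>0 y * log (exp 1) (nef_density h A \<theta>0 y / nef_density h A \<theta> y)
   = (nef_density h A \<theta>0 y *\<^sub>R y) \<bullet> (\<theta>0 - \<theta>) + (A \<theta> - A \<theta>0) * nef_density h A \<theta>0 y"
proof (cases "h y = 0")
  case False
  then have "nef_density h A \<theta>0 y / nef_density h A \<theta> y = exp (y \<bullet> \<theta>0 - A \<theta>0 - (y \<bullet> \<theta> - A \<theta>))"
    by (simp add: nef_density_def exp_diff)
  then have "log (exp 1) (nef_density h A \<theta>0 y / nef_density h A \<theta> y) = y \<bullet> \<theta>0 - A \<theta>0 - (y \<bullet> \<theta> - A \<theta>)"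
    by (simp add: log_def)
  then show ?thesis by (simp only: inner_scaleR_left) (simp add: inner_diff_right algebra_simps)
qed (simp add: nef_density_def)

lemma integrable_nef_KL:
  "integrable lborel (\<lambda>y. nef_density h A \<theta>0 y * log (exp 1) (nef_density h A \<theta>0 y / nef_density h A \<theta> y))"
  unfolding nef_KL_integrand
  by (intro Bochner_Integration.integrable_add integrable_inner_left integrable_mult_right)
     (auto intro: integrable_nef_id integrable_nef_density)

lemma nef_density_ac: "nef_density h A \<theta> y = 0 \<longrightarrow> nef_density h A \<theta>0 y = 0"
  by (simp add: nef_density_def)

text \<open>Integrating the affine log-likelihood ratio replaces \<open>y\<close> by its mean, which
  is the gradient of \<open>A\<close>.\<close>

lemma nef_KL_eq: "nef_KL h A \<theta>0 \<theta> = A \<theta> - A \<theta>0 - gradient A \<theta>0 \<bullet> (\<theta> - \<theta>0)"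
proof -
  have "nef_KL h A \<theta>0 \<theta> = (LINT y|lborel. nef_density h A \<theta>0 y * log (exp 1) (nef_density h A \<theta>0 y / nef_density h A \<theta> y))"
    unfolding nef_KL_def nef_def
    by (rule lborel.KL_density_density) (auto simp: nef_density_nonneg nef_density_ac)
  also have "\<dots> = nef_mean \<theta>0 \<bullet> (\<theta>0 - \<theta>) + (A \<theta> - A \<theta>0)"
    unfolding nef_KL_integrand
    using integrable_nef_id[of \<theta>0] integrable_nef_density[of \<theta>0]
    by (subst Bochner_Integration.integral_add) (auto simp: nef_mean_def integral_nef_density simp del: inner_scaleR_left)
  finally show ?thesis
    by (simp add: gradient_log_partition inner_diff_right)
qed

lemma nef_KL_nonneg: "0 \<le> nef_KL h A \<theta>0 \<theta>"
  unfolding nef_KL_def nef_def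
  by (rule lborel.KL_density_density_nonneg)
     (use nef integrable_nef_KL in \<open>auto simp: nef_density_nonneg nef_density_ac natural_exponential_family_def nef_def\<close>)

end

subsection \<open>Exhausting cutoffs\<close>

text \<open>The factor \<open>exp 1\<close> makes the value at the origin 1. A fixed profile is
  dilated to the ball of radius \<open>n + 1\<close>, so that its gradient is of order
  \<open>1 / n\<close>.\<close>

definition cutoff :: "nat \<Rightarrow> real^'d \<Rightarrow> real" where
  "cutoff n x = exp 1 * flat 1 (1 - (x \<bullet> x) / (real (Suc n))\<^sup>2)"

lemma Ck_cutoff_arg: "Ck k (\<lambda>x::real^'d. 1 - (x \<bullet> x) / c)"
proof -
  have "Ck k (\<lambda>x::real^'d. 1 + (- 1 / c) * (x \<bullet> x))"
    by (intro Ck_add Ck_mult Ck_const Ck_inner_self)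
  then show ?thesis by simp
qed

lemma flat_nonzero: "flat P t \<noteq> 0 \<Longrightarrow> 0 < t"
  by (auto simp: flat_def split: if_splits)

lemma cutoff_arg_pos:
  fixes x :: "real^'d"
  assumes "0 < 1 - (x \<bullet> x) / (real (Suc n))\<^sup>2"
  shows "norm x < Suc n"
proof -
  have "(norm x)\<^sup>2 < (real (Suc n))\<^sup>2"
    using assms by (simp add: power2_norm_eq_inner field_simps)
  then show ?thesis by (rule power_less_imp_less_base) simp
qed

lemma test_function_cutoff: "test_function (cutoff n)"
proof (rule test_functionI[of _ "Suc n"])
  show "Ck k (cutoff n)" for k
    unfolding cutoff_def[abs_def] by (intro Ck_mult Ck_const Ck_flat_comp Ck_cutoff_arg)
  show "norm x \<le> Suc n" if "cutoff n x \<noteq> 0" for x :: "real^'a"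
    using that cutoff_arg_pos[of x n] flat_nonzero by (force simp: cutoff_def)
qed

lemma cutoff_nonneg: "0 \<le> cutoff n x"
  by (simp add: cutoff_def flat_def)

lemma cutoff_le_1: "cutoff n x \<le> 1"
proof -
  have "flat 1 t \<le> exp (- 1)" if "t \<le> 1" for t
    using that by (auto simp: flat_def field_simps)
  from this[of "1 - (x \<bullet> x) / (real (Suc n))\<^sup>2"] have "flat 1 (1 - (x \<bullet> x) / (real (Suc n))\<^sup>2) \<le> exp (- 1)"
    by simp
  then show ?thesis by (simp add: cutoff_def exp_minus field_simps)
qed

lemma cutoff_tendsto: "(\<lambda>n. cutoff n x) \<longlonglongrightarrow> 1"
proof -
  have "(\<lambda>n. inverse (real (Suc n))) \<longlonglongrightarrow> 0" by (rule LIMSEQ_inverse_real_of_nat)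
  then have "(\<lambda>n. 1 - (x \<bullet> x) * (inverse (real (Suc n)))\<^sup>2) \<longlonglongrightarrow> 1 - (x \<bullet> x) * 0\<^sup>2"
    by (intro tendsto_intros)
  then have "(\<lambda>n. 1 - (x \<bullet> x) / (real (Suc n))\<^sup>2) \<longlonglongrightarrow> 1"
    by (simp add: divide_inverse power_inverse)
  then have "(\<lambda>n. flat 1 (1 - (x \<bullet> x) / (real (Suc n))\<^sup>2)) \<longlonglongrightarrow> flat 1 1"
    by (rule isCont_tendsto_compose[OF DERIV_isCont[OF flat_has_derivative]])
  from tendsto_mult[OF tendsto_const[of "exp 1"] this] show ?thesis
    by (simp add: cutoff_def[abs_def] flat_def exp_minus)
qed

text \<open>In the constant, \<open>exp 1\<close> is the normalisation, one factor 2 bounds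
  \<open>s^2 * exp (- s)\<close>, the derivative of the profile at \<open>t = 1/s\<close>, and the
  other comes from differentiating \<open>x \<bullet> x\<close>. On the support a coordinate is at
  most \<open>n + 1\<close>, against \<open>(n + 1)^2\<close> in the denominator.\<close>

lemma cutoff_partial_bound: "\<bar>partial_deriv j (cutoff n) x\<bar> \<le> 4 * exp 1 / Suc n"
proof -
  let ?q = "\<lambda>x::real^'a. 1 - (x \<bullet> x) / (real (Suc n))\<^sup>2"
  have dq: "(?q has_derivative (\<lambda>v. - (2 * (x \<bullet> v)) / (real (Suc n))\<^sup>2)) (at x)"
  proof -
    have "((\<lambda>x::real^'a. 1 - (x \<bullet> x) * c) has_derivative (\<lambda>v. - (2 * (x \<bullet> v)) * c)) (at x)" for c
      by (auto intro!: derivative_eq_intros simp: inner_commute)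
    from this[of "1 / (real (Suc n))\<^sup>2"] show ?thesis by simp
  qed
  have "partial_deriv j (\<lambda>x. exp 1 * flat 1 (?q x)) x = exp 1 * flat (flat_deriv 1) (?q x) * partial_deriv j ?q x"
    by (rule partial_deriv_comp[where q="?q" and \<phi>="\<lambda>t. exp 1 * flat 1 t", OF DERIV_cmult[OF flat_has_derivative]])
       (use dq in \<open>auto simp: differentiable_def\<close>)
  then have "partial_deriv j (cutoff n) x = exp 1 * flat (flat_deriv 1) (?q x) * partial_deriv j ?q x"
    by (simp only: cutoff_def[abs_def])
  also have "partial_deriv j ?q x = - (2 * x $ j) / (real (Suc n))\<^sup>2"
    using partial_deriv_eq[OF dq, of j] by (simp add: inner_axis)
  finally have eq: "partial_deriv j (cutoff n) x = exp 1 * flat (flat_deriv 1) (?q x) * (- (2 * x $ j) / (real (Suc n))\<^sup>2)" .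
  show ?thesis
  proof (cases "flat (flat_deriv 1) (?q x) = 0")
    case False
    then have q: "0 < ?q x" by (rule flat_nonzero)
    then have "\<bar>x $ j\<bar> \<le> Suc n" using cutoff_arg_pos[OF q] component_le_norm_cart[of x j] by simp
    then have "\<bar>- (2 * x $ j) / (real (Suc n))\<^sup>2\<bar> \<le> 2 * real (Suc n) / (real (Suc n))\<^sup>2"
      by (simp add: divide_right_mono)
    also have "\<dots> = 2 / real (Suc n)"
      by (simp add: power2_eq_square del: of_nat_Suc)
    finally have 1: "\<bar>- (2 * x $ j) / (real (Suc n))\<^sup>2\<bar> \<le> 2 / real (Suc n)" .
    \<comment> \<open>From the Taylor bound \<open>1 + s + s^2 / 2 \<le> exp s\<close>.\<close>
    have "s\<^sup>2 * exp (- s) \<le> 2" if "0 < s" for s :: real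
      using exp_lower_Taylor_quadratic[of s] that by (simp add: exp_minus field_simps)
    from this[of "1 / ?q x"] have 2: "\<bar>flat (flat_deriv 1) (?q x)\<bar> \<le> 2"
      using q by (simp add: flat_def flat_deriv_def power2_eq_square pderiv_1 abs_mult)
    have "\<bar>partial_deriv j (cutoff n) x\<bar> \<le> exp 1 * 2 * (2 / real (Suc n))"
      unfolding eq abs_mult by (intro mult_mono 1 2) auto
    then show ?thesis by simp
  qed (simp add: eq)
qed

subsection \<open>Extended expectations\<close>

text \<open>Since \<open>ennreal\<close> truncates at 0, these are integrals of positive parts, and
  the positive part is subadditive. Rearranging one identity between three functions thus bounds the
  positive part of each by the others.\<close>

lemma nn_integral_pos_part_add_less_top:
  assumes "f \<in> borel_measurable M" "g \<in> borel_measurable M"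
    and "(\<integral>\<^sup>+x. ennreal (f x) \<partial>M) < \<infinity>" "(\<integral>\<^sup>+x. ennreal (g x) \<partial>M) < \<infinity>"
    and "AE x in M. u x \<le> f x + g x"
  shows "(\<integral>\<^sup>+x. ennreal (u x) \<partial>M) < \<infinity>"
proof -
  have "(\<integral>\<^sup>+x. ennreal (u x) \<partial>M) \<le> (\<integral>\<^sup>+x. ennreal (f x) + ennreal (g x) \<partial>M)"
  proof (rule nn_integral_mono_AE)
    have "ennreal (a + b) \<le> ennreal a + ennreal b" for a b :: real
      by (cases "0 \<le> a"; cases "0 \<le> b") (auto simp: ennreal_neg intro!: ennreal_leI)
    then show "AE x in M. ennreal (u x) \<le> ennreal (f x) + ennreal (g x)"
      using assms(5) by (auto elim!: eventually_mono intro: order_trans[OF ennreal_leI])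
  qed
  also have "\<dots> = (\<integral>\<^sup>+x. ennreal (f x) \<partial>M) + (\<integral>\<^sup>+x. ennreal (g x) \<partial>M)"
    using assms(1,2) by (intro nn_integral_add) auto
  also have "\<dots> < \<infinity>" using assms(3,4) by simp
  finally show ?thesis .
qed

lemma integrable_iff_parts:
  fixes f :: "'a \<Rightarrow> real"
  assumes "f \<in> borel_measurable M"
  shows "integrable M f \<longleftrightarrow> (\<integral>\<^sup>+x. ennreal (f x) \<partial>M) < \<infinity> \<and> (\<integral>\<^sup>+x. ennreal (- f x) \<partial>M) < \<infinity>"
  using assms by (auto simp: real_integrable_def less_top)

text \<open>Fatou bounds the other part by the given one, because the cut-off integrals vanish in the limit.\<close>

lemma integral_0_by_cutoff:
  fixes Z :: "'a \<Rightarrow> real" and \<eta> :: "nat \<Rightarrow> 'a \<Rightarrow> real"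
  assumes Z: "Z \<in> borel_measurable M"
    and \<eta>: "\<And>n. \<eta> n \<in> borel_measurable M" "\<And>n x. 0 \<le> \<eta> n x" "\<And>n x. \<eta> n x \<le> 1"
      "\<And>x. (\<lambda>n. \<eta> n x) \<longlonglongrightarrow> 1"
    and int: "\<And>n. integrable M (\<lambda>x. \<eta> n x * Z x)"
    and lim: "(\<lambda>n. LINT x|M. \<eta> n x * Z x) \<longlonglongrightarrow> 0"
    and part: "(\<integral>\<^sup>+x. ennreal (Z x) \<partial>M) < \<infinity>"
  shows "integrable M Z \<and> (LINT x|M. Z x) = 0"
proof -
  note [measurable] = Z \<eta>(1)
  let ?p = "\<lambda>x. max 0 (Z x)" and ?m = "\<lambda>x. max 0 (- Z x)"
  have nnp: "(\<integral>\<^sup>+x. ennreal (?p x) \<partial>M) = (\<integral>\<^sup>+x. ennreal (Z x) \<partial>M)"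
    by (intro nn_integral_cong) (simp add: max_def ennreal_neg)
  have Ip: "integrable M ?p"
    by (rule integrableI_nonneg) (use part nnp in auto)
  have "(\<lambda>n. LINT x|M. \<eta> n x * ?p x) \<longlonglongrightarrow> (LINT x|M. ?p x)"
  proof (rule integral_dominated_convergence[where w="?p"])
    show "AE x in M. (\<lambda>n. \<eta> n x * ?p x) \<longlonglongrightarrow> ?p x"
      using tendsto_mult[OF \<eta>(4) tendsto_const] by (intro AE_I2) simp
    show "AE x in M. norm (\<eta> n x * ?p x) \<le> ?p x" for n
      using \<eta>(2,3) by (intro AE_I2) (simp add: abs_mult mult_left_le_one_le)
  qed (use Ip in auto)
  from tendsto_diff[OF this lim]
  have lm: "(\<lambda>n. (LINT x|M. \<eta> n x * ?p x) - (LINT x|M. \<eta> n x * Z x)) \<longlonglongrightarrow> (LINT x|M. ?p x)" by simp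
  have Icp: "integrable M (\<lambda>x. \<eta> n x * ?p x)" for n
    by (rule Bochner_Integration.integrable_bound[OF Ip])
       (use \<eta>(2,3) in \<open>auto simp: abs_mult mult_left_le_one_le\<close>)
  \<comment> \<open>The cut-off negative part is the cut-off positive part minus the cut-off
    \<open>Z\<close>. The integral of the former converges by domination, that of the latter to 0,
    so Fatou bounds the negative part by the integral of the positive part.\<close>
  have cm: "(\<integral>\<^sup>+x. ennreal (\<eta> n x * ?m x) \<partial>M) = ennreal ((LINT x|M. \<eta> n x * ?p x) - (LINT x|M. \<eta> n x * Z x))" for n
  proof -
    have eq: "\<eta> n x * ?m x = \<eta> n x * ?p x - \<eta> n x * Z x" for x
      by (simp add: max_def)
    have "(\<integral>\<^sup>+x. ennreal (\<eta> n x * ?m x) \<partial>M) = ennreal (LINT x|M. \<eta> n x * ?m x)"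
      by (rule nn_integral_eq_integral)
         (use \<eta>(2) Icp[of n] int[of n] in \<open>auto simp: eq intro!: AE_I2 mult_left_mono\<close>)
    then show ?thesis using Icp[of n] int[of n] by (simp add: eq)
  qed
  have "(\<integral>\<^sup>+x. ennreal (?m x) \<partial>M) = (\<integral>\<^sup>+x. liminf (\<lambda>n. ennreal (\<eta> n x * ?m x)) \<partial>M)"
  proof (intro nn_integral_cong lim_imp_Liminf[symmetric])
    fix x
    show "(\<lambda>n. ennreal (\<eta> n x * ?m x)) \<longlonglongrightarrow> ennreal (?m x)"
      using tendsto_mult[OF \<eta>(4) tendsto_const, of x "?m x"] by (intro tendsto_ennrealI) simp
  qed simp
  also have "\<dots> \<le> liminf (\<lambda>n. \<integral>\<^sup>+x. ennreal (\<eta> n x * ?m x) \<partial>M)"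
    by (rule nn_integral_liminf) measurable
  also have "\<dots> = ennreal (LINT x|M. ?p x)"
    unfolding cm by (intro lim_imp_Liminf tendsto_ennrealI lm) simp
  also have "\<dots> < \<infinity>" by simp
  finally have "(\<integral>\<^sup>+x. ennreal (?m x) \<partial>M) < \<infinity>" .
  moreover have "(\<integral>\<^sup>+x. ennreal (?m x) \<partial>M) = (\<integral>\<^sup>+x. ennreal (- Z x) \<partial>M)"
    by (intro nn_integral_cong) (simp add: max_def ennreal_neg)
  ultimately have IZ: "integrable M Z"
    using part by (simp add: integrable_iff_parts[OF Z])
  have "(\<lambda>n. LINT x|M. \<eta> n x * Z x) \<longlonglongrightarrow> (LINT x|M. Z x)"
  proof (rule integral_dominated_convergence[where w="\<lambda>x. \<bar>Z x\<bar>"])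
    show "AE x in M. (\<lambda>n. \<eta> n x * Z x) \<longlonglongrightarrow> Z x"
      using tendsto_mult[OF \<eta>(4) tendsto_const] by (intro AE_I2) simp
    show "AE x in M. norm (\<eta> n x * Z x) \<le> \<bar>Z x\<bar>" for n
      using \<eta>(2,3) by (intro AE_I2) (simp add: abs_mult mult_left_le_one_le)
  qed (use IZ in auto)
  then have "(LINT x|M. Z x) = 0" using lim by (rule LIMSEQ_unique)
  with IZ show ?thesis by simp
qed

lemma ext_expectation_cong_AE:
  assumes "AE x in M. X x = X' x"
  shows "ext_expectation M X = ext_expectation M X'"
proof -
  have "(\<integral>\<^sup>+x. ennreal (X x) \<partial>M) = (\<integral>\<^sup>+x. ennreal (X' x) \<partial>M)"
    "(\<integral>\<^sup>+x. ennreal (- X x) \<partial>M) = (\<integral>\<^sup>+x. ennreal (- X' x) \<partial>M)"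
    by (intro nn_integral_cong_AE; use assms in \<open>auto elim!: eventually_mono\<close>)+
  then show ?thesis by (simp add: ext_expectation_def)
qed

text \<open>Nonnegativity of \<open>D\<close> turns existence of either part of the expectation of \<open>X\<close> into
  integrability of one part of \<open>Z\<close>, unless both sides are infinite.\<close>

lemma ext_expectation_remove_mean_zero:
  fixes X D Z :: "'w \<Rightarrow> real"
  assumes M: "prob_space M" and X: "has_expectation M X" and Z: "Z \<in> borel_measurable M"
    and eq: "AE x in M. X x = D x - a + Z x" and D: "AE x in M. 0 \<le> D x"
    and zero: "(\<integral>\<^sup>+x. ennreal (Z x) \<partial>M) < \<infinity> \<or> (\<integral>\<^sup>+x. ennreal (- Z x) \<partial>M) < \<infinity>
      \<Longrightarrow> integrable M Z \<and> (LINT x|M. Z x) = 0"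
  shows "ext_expectation M X = ext_expectation M D - ereal a"
proof -
  interpret prob_space M by fact
  have Xm: "X \<in> borel_measurable M" using X by (simp add: has_expectation_def)
  \<comment> \<open>A measurable version of \<open>D\<close>: in the application \<open>D\<close>
    contains the inverse \<open>inv\<close>, whose measurability is unknown, whereas
    \<open>X\<close> and \<open>Z\<close> are measurable.\<close>
  define D' where "D' x = X x - Z x + a" for x
  have D'm: "D' \<in> borel_measurable M" unfolding D'_def[abs_def] using Xm Z by measurable
  have D'0: "AE x in M. 0 \<le> D' x"
    using eq D by eventually_elim (simp add: D'_def)
  have DD': "ext_expectation M D = ext_expectation M D'"
    by (rule ext_expectation_cong_AE) (use eq in eventually_elim, simp add: D'_def)
  have c: "(\<integral>\<^sup>+x. ennreal b \<partial>M) < \<infinity>" for b by (simp add: emeasure_space_1)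
  have mZ: "(\<lambda>x. - Z x) \<in> borel_measurable M" and mX: "(\<lambda>x. - X x) \<in> borel_measurable M"
    and ZX: "(\<lambda>x. X x + a) \<in> borel_measurable M"
    using Z Xm by measurable
  have both: ?thesis if "integrable M X" "integrable M Z" "(LINT x|M. Z x) = 0"
  proof -
    have "integrable M D'" "(LINT x|M. D' x) = (LINT x|M. X x) + a"
      unfolding D'_def using that prob_space by auto
    then show ?thesis
      by (simp add: DD' ext_expectation_integrable that)
  qed
  show ?thesis
  proof (cases "(\<integral>\<^sup>+x. ennreal (X x) \<partial>M) < \<infinity>")
    case True
    \<comment> \<open>Nonnegativity of \<open>D'\<close> says \<open>Z \<le> X + a\<close>. Once
      \<open>Z\<close> is integrable, the same inequality, read as \<open>- X \<le> - Z + a\<close>,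
      controls the other part of \<open>X\<close>.\<close>
    have "(\<integral>\<^sup>+x. ennreal (Z x) \<partial>M) < \<infinity>"
      by (rule nn_integral_pos_part_add_less_top[OF Xm _ True c[of a]])
         (use D'0 in \<open>auto simp: D'_def elim!: eventually_mono\<close>)
    then have IZ: "integrable M Z" "(LINT x|M. Z x) = 0" using zero by auto
    have "(\<integral>\<^sup>+x. ennreal (- X x) \<partial>M) < \<infinity>"
      by (rule nn_integral_pos_part_add_less_top[OF mZ _ _ c[of a]])
         (use D'0 IZ(1) integrable_iff_parts[OF Z] in \<open>auto simp: D'_def elim!: eventually_mono\<close>)
    with True have "integrable M X" by (simp add: integrable_iff_parts[OF Xm])
    with IZ show ?thesis by (intro both)
  next
    case False
    with X have neg: "(\<integral>\<^sup>+x. ennreal (- X x) \<partial>M) < \<infinity>" by (simp add: has_expectation_def)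
    \<comment> \<open>Otherwise \<open>- Z = D' - X - a\<close> has a finite positive part, so
      \<open>Z\<close> is integrable, and then \<open>X = D' - a + Z\<close> has a finite positive
      part, contrary to this case. Hence both sides of the claim are infinite.\<close>
    have "\<not> (\<integral>\<^sup>+x. ennreal (D' x) \<partial>M) < \<infinity>"
    proof
      assume fin: "(\<integral>\<^sup>+x. ennreal (D' x) \<partial>M) < \<infinity>"
      have "(\<integral>\<^sup>+x. ennreal (- X x + - a) \<partial>M) < \<infinity>"
        by (rule nn_integral_pos_part_add_less_top[OF mX _ neg c[of "- a"]]) auto
      then have "(\<integral>\<^sup>+x. ennreal (- Z x) \<partial>M) < \<infinity>"
        by (rule nn_integral_pos_part_add_less_top[OF D'm _ fin, rotated]) (use mX in \<open>auto simp: D'_def\<close>)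
      then have IZ: "integrable M Z" using zero by auto
      have "(\<integral>\<^sup>+x. ennreal (D' x + - a) \<partial>M) < \<infinity>"
        by (rule nn_integral_pos_part_add_less_top[OF D'm _ fin c[of "- a"]]) auto
      then have "(\<integral>\<^sup>+x. ennreal (X x) \<partial>M) < \<infinity>"
        by (rule nn_integral_pos_part_add_less_top[OF _ Z, rotated])
           (use Xm Z IZ integrable_iff_parts[OF Z] in \<open>auto simp: D'_def\<close>)
      with False show False by simp
    qed
    then have "(\<integral>\<^sup>+x. ennreal (D' x) \<partial>M) = \<infinity>" by (metis infinity_ennreal_def less_top)
    moreover have "(\<integral>\<^sup>+x. ennreal (- D' x) \<partial>M) = 0"
      using D'0 D'm by (subst nn_integral_0_iff_AE) (auto elim!: eventually_mono simp: ennreal_neg)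
    moreover have "(\<integral>\<^sup>+x. ennreal (X x) \<partial>M) = \<infinity>" using False by (metis infinity_ennreal_def less_top)
    moreover obtain r where "0 \<le> r" "(\<integral>\<^sup>+x. ennreal (- X x) \<partial>M) = ennreal r"
      using neg by (cases "\<integral>\<^sup>+x. ennreal (- X x) \<partial>M") auto
    ultimately show ?thesis
      unfolding DD' by (simp add: ext_expectation_def enn2ereal_ennreal)
  qed
qed

subsection \<open>The divergence identity\<close>

lemma Ck_exp_inner: "Ck k (\<lambda>y::real^'d. exp (y \<bullet> \<theta>))"
  by (intro Ck_exp Ck_linear bounded_linear_inner_left)

lemma partial_deriv_exp_inner: "partial_deriv j (\<lambda>y. exp (y \<bullet> \<theta>)) y = exp (y \<bullet> \<theta>) * \<theta> $ j"
proof -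
  have "((\<lambda>y. exp (y \<bullet> \<theta>)) has_derivative (\<lambda>v. exp (y \<bullet> \<theta>) * (v \<bullet> \<theta>))) (at y)"
    by (auto intro!: derivative_eq_intros)
  from partial_deriv_eq[OF this] show ?thesis by (simp add: inner_axis')
qed

text \<open>Up to the factor \<open>exp (A \<theta>)\<close>, \<open>T n\<close> is the cutoff times
  the derivative in direction \<open>j\<close> of the density times \<open>f\<close>. The smooth
  factor \<open>exp (y \<bullet> \<theta>)\<close> joins the test function, so the product rule only
  has to handle \<open>f\<close> and \<open>h\<close>. Its derivative accounts for the summand with
  \<open>\<theta> $ j\<close>, and what is left over is the derivative of the cutoff.\<close>

lemma divergence_component_limit:
  fixes f g h k A :: "real^'d \<Rightarrow> real" and \<theta> :: "real^'d"
  assumes nef: "natural_exponential_family h A"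
    and f: "has_weak_partial_deriv j f g" and h: "has_weak_partial_deriv j h k"
    and bf: "AE x in lborel. \<bar>f x\<bar> \<le> K * (1 + norm x)" and bg: "AE x in lborel. \<bar>g x\<bar> \<le> C"
  defines "T \<equiv> \<lambda>n y. cutoff n y * exp (y \<bullet> \<theta>) *
    (f y * (if 0 < h y then k y else 0) + g y * h y + \<theta> $ j * (f y * h y))"
  shows "integrable lborel (T n)" and "(\<lambda>n. LINT y|lborel. T n y) \<longlonglongrightarrow> 0"
proof -
  define \<psi> where "\<psi> n y = cutoff n y * exp (y \<bullet> \<theta>)" for n and y :: "real^'d"
  define G where "G y = K * (h y * exp (y \<bullet> \<theta>) + h y * exp (y \<bullet> \<theta>) * norm y)" for y
  note h0 = nef_base_nonneg[OF nef]
  have \<psi>: "test_function (\<psi> n)" for n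
    unfolding \<psi>_def[abs_def] by (intro test_function_mult test_function_cutoff Ck_exp_inner)
  have pc: "test_function (partial_deriv j (cutoff n))" for n
    by (rule test_function_partial[OF test_function_cutoff])
  have [measurable]: "f \<in> borel_measurable borel" "h \<in> borel_measurable borel"
    "\<psi> n \<in> borel_measurable borel" "partial_deriv j (cutoff n) \<in> borel_measurable borel" for n
    using locally_integrable_measurable has_weak_partial_derivD(1)[OF f] nef_base_measurable[OF nef]
      measurable_test_function[OF \<psi>] measurable_test_function[OF pc] by blast+
  have IG: "integrable lborel G"
    unfolding G_def[abs_def]
    by (intro integrable_mult_right Bochner_Integration.integrable_add integrable_nef_norm[OF nef]
        integrable_nef_exp_norm[OF nef, of 0, simplified])
  have bG: "AE y in lborel. \<bar>f y\<bar> * (exp (y \<bullet> \<theta>) * h y) \<le> G y"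
    using bf
  proof eventually_elim
    case (elim y)
    have "\<bar>f y\<bar> * (exp (y \<bullet> \<theta>) * h y) \<le> K * (1 + norm y) * (exp (y \<bullet> \<theta>) * h y)"
      using elim h0 by (intro mult_right_mono) auto
    then show ?case by (simp add: G_def algebra_simps)
  qed
  have pd: "partial_deriv j (\<psi> n) y = \<theta> $ j * \<psi> n y + partial_deriv j (cutoff n) y * exp (y \<bullet> \<theta>)" for n y
    unfolding \<psi>_def[abs_def]
    by (subst partial_deriv_mult)
       (auto simp: partial_deriv_exp_inner intro: test_function_differentiable[OF test_function_cutoff] Ck_differentiable[OF Ck_exp_inner])
  \<comment> \<open>Used with \<open>w\<close> the derivative of the cutoff, where \<open>b\<close>
    is of order \<open>1 / n\<close>, and with \<open>w\<close> the cutoff itself, where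
    \<open>b = 1\<close>.\<close>
  have bterm: "integrable lborel (\<lambda>y. f y * w y * (exp (y \<bullet> \<theta>) * h y)) \<and>
      \<bar>LINT y|lborel. f y * w y * (exp (y \<bullet> \<theta>) * h y)\<bar> \<le> b * (LINT y|lborel. G y)"
    if [measurable]: "w \<in> borel_measurable borel" and w: "\<And>y. \<bar>w y\<bar> \<le> b" for w b
  proof -
    have le: "AE y in lborel. \<bar>f y * w y * (exp (y \<bullet> \<theta>) * h y)\<bar> \<le> b * G y"
      using bG
    proof eventually_elim
      case (elim y)
      have "0 \<le> b" using w[of y] by simp
      have "\<bar>f y * w y * (exp (y \<bullet> \<theta>) * h y)\<bar> = \<bar>w y\<bar> * (\<bar>f y\<bar> * (exp (y \<bullet> \<theta>) * h y))"
        by (simp add: abs_mult h0)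
      also have "\<dots> \<le> b * G y" using w[of y] elim \<open>0 \<le> b\<close> h0[of y] by (intro mult_mono) auto
      finally show ?case .
    qed
    have I: "integrable lborel (\<lambda>y. f y * w y * (exp (y \<bullet> \<theta>) * h y))"
      by (rule Bochner_Integration.integrable_bound[OF integrable_mult_right[OF IG, of b]])
         (measurable, use le in \<open>auto elim!: eventually_mono\<close>)
    have "\<bar>LINT y|lborel. f y * w y * (exp (y \<bullet> \<theta>) * h y)\<bar> \<le> (LINT y|lborel. \<bar>f y * w y * (exp (y \<bullet> \<theta>) * h y)\<bar>)"
      by (rule integral_abs_bound)
    also have "\<dots> \<le> (LINT y|lborel. b * G y)"
      by (rule integral_mono_AE) (use I IG le in auto)
    finally show ?thesis using I by simp
  qed
  have bd: "integrable lborel (\<lambda>y. f y * partial_deriv j (cutoff n) y * (exp (y \<bullet> \<theta>) * h y))"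
    "\<bar>LINT y|lborel. f y * partial_deriv j (cutoff n) y * (exp (y \<bullet> \<theta>) * h y)\<bar>
      \<le> 4 * exp 1 / Suc n * (LINT y|lborel. G y)" for n
    using bterm[OF measurable_test_function[OF pc], OF cutoff_partial_bound, of n] by blast+
  have mc: "cutoff n \<in> borel_measurable borel" for n
    by (rule measurable_test_function[OF test_function_cutoff])
  have Ic: "integrable lborel (\<lambda>y. f y * \<psi> n y * h y)" for n
  proof -
    have "integrable lborel (\<lambda>y. f y * cutoff n y * (exp (y \<bullet> \<theta>) * h y))"
      by (rule conjunct1[OF bterm[OF mc, where b=1]]) (simp add: abs_of_nonneg[OF cutoff_nonneg] cutoff_le_1)
    then show ?thesis by (simp add: \<psi>_def mult_ac)
  qed
  note pr = weak_product_rule[OF f h h0 \<psi> bf bg]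
  have Teq: "T n y = (f y * \<psi> n y * (if 0 < h y then k y else 0) + g y * \<psi> n y * h y) + \<theta> $ j * (f y * \<psi> n y * h y)" for n y
    by (simp add: T_def \<psi>_def algebra_simps)
  show int: "integrable lborel (T n)" for n
    unfolding Teq by (intro Bochner_Integration.integrable_add integrable_mult_right pr(1,2) Ic)
  have val: "(LINT y|lborel. T n y) = - (LINT y|lborel. f y * partial_deriv j (cutoff n) y * (exp (y \<bullet> \<theta>) * h y))" for n
  proof -
    have "(LINT y|lborel. T n y) = (LINT y|lborel. f y * \<psi> n y * (if 0 < h y then k y else 0))
        + (LINT y|lborel. g y * \<psi> n y * h y) + \<theta> $ j * (LINT y|lborel. f y * \<psi> n y * h y)"
      unfolding Teq using pr(1,2)[of n] Ic[of n] by (simp del: mult_if_delta)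
    also have "\<dots> = \<theta> $ j * (LINT y|lborel. f y * \<psi> n y * h y) - (LINT y|lborel. f y * partial_deriv j (\<psi> n) y * h y)"
      using pr(3)[of n] by simp
    also have "(LINT y|lborel. f y * partial_deriv j (\<psi> n) y * h y)
        = (LINT y|lborel. \<theta> $ j * (f y * \<psi> n y * h y) + f y * partial_deriv j (cutoff n) y * (exp (y \<bullet> \<theta>) * h y))"
      by (intro Bochner_Integration.integral_cong refl) (simp add: pd algebra_simps)
    also have "\<dots> = \<theta> $ j * (LINT y|lborel. f y * \<psi> n y * h y)
        + (LINT y|lborel. f y * partial_deriv j (cutoff n) y * (exp (y \<bullet> \<theta>) * h y))"
      using Ic[of n] bd(1)[of n] by simp
    finally show ?thesis by simp
  qed
  show "(\<lambda>n. LINT y|lborel. T n y) \<longlonglongrightarrow> 0"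
  proof (rule Lim_null_comparison)
    show "\<forall>\<^sub>F n in sequentially. norm (LINT y|lborel. T n y) \<le> 4 * exp 1 / Suc n * (LINT y|lborel. G y)"
      using bd(2) by (auto simp: val)
    have "(\<lambda>n. 4 * exp 1 * (LINT y|lborel. G y) * inverse (real (Suc n))) \<longlonglongrightarrow> 4 * exp 1 * (LINT y|lborel. G y) * 0"
      by (intro tendsto_intros LIMSEQ_inverse_real_of_nat)
    then show "(\<lambda>n. 4 * exp 1 / Suc n * (LINT y|lborel. G y)) \<longlonglongrightarrow> 0"
      by (simp add: divide_inverse mult_ac)
  qed
qed

theorem theorem4p1:
  fixes M :: "'w measure" and Y :: "'w \<Rightarrow> real^'d"
    and h A :: "real^'d \<Rightarrow> real" and Dh :: "real^'d \<Rightarrow> real^'d"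
    and muhat :: "real^'d \<Rightarrow> real^'d" and J :: "real^'d \<Rightarrow> real^'d^'d"
    and \<theta> :: "real^'d"
  assumes "prob_space M"
    and "natural_exponential_family h A"
    and "inj (gradient A)"
    and "distributed M lborel Y (\<lambda>y. ennreal (nef_density h A \<theta> y))"
    and "AE \<omega> in M. muhat (Y \<omega>) \<in> range (gradient A)"
    and "has_weak_jacobian muhat J"
    and "\<forall>i j. essentially_bounded (\<lambda>y. J y $ i $ j)"
    and "has_weak_gradient h Dh"
    and "has_expectation M (\<lambda>\<omega>. SUKLS h Dh A muhat J (Y \<omega>))"
  shows "ext_expectation M (\<lambda>\<omega>. SUKLS h Dh A muhat J (Y \<omega>)) = MKLS M Y h A muhat \<theta> - ereal (A \<theta>)"
proof -
  note nef = assms(2) and dist = assms(4)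
  have wm: "has_weak_partial_deriv j (\<lambda>y. muhat y $ i) (\<lambda>y. J y $ i $ j)" for i j
    using assms(6) by (simp add: has_weak_jacobian_def has_weak_gradient_def)
  have wh: "has_weak_partial_deriv j h (\<lambda>y. Dh y $ j)" for j
    using assms(8) by (simp add: has_weak_gradient_def)
  have "\<forall>i j. \<exists>C. AE y in lborel. \<bar>J y $ i $ j\<bar> \<le> C"
    using assms(7) by (simp add: essentially_bounded_def)
  then obtain C where C: "\<And>i j. AE y in lborel. \<bar>J y $ i $ j\<bar> \<le> C i j" by metis
  have "\<exists>K. AE y in lborel. \<bar>muhat y $ i\<bar> \<le> K * (1 + norm y)" for i
    using weak_derivative_linear_growth[OF wm C, of i] by blast
  then obtain K where K: "\<And>i. AE y in lborel. \<bar>muhat y $ i\<bar> \<le> K i * (1 + norm y)" by metis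
  note meas[measurable] = nef_base_measurable[OF nef] nef_density_measurable[OF nef]
    has_weak_partial_derivD(1,2)[OF wm, THEN locally_integrable_measurable]
    has_weak_partial_derivD(2)[OF wh, THEN locally_integrable_measurable]
  note [measurable] = distributed_measurable[OF dist, simplified] measurable_test_function[OF test_function_cutoff]
  define Z where "Z y = (\<Sum>i\<in>UNIV. Dh y $ i / h y * muhat y $ i + J y $ i $ i + \<theta> $ i * muhat y $ i)" for y
  have Zm[measurable]: "Z \<in> borel_measurable borel" unfolding Z_def[abs_def] by measurable
  \<comment> \<open>The cutoff times \<open>Z\<close> with the denominator cleared by the weight
    \<open>h y * exp (y \<bullet> \<theta>)\<close>, as a sum of terms covered by
    \<open>divergence_component_limit\<close> with \<open>j = i\<close>.\<close>
  define S where "S n y = (\<Sum>i\<in>UNIV. cutoff n y * exp (y \<bullet> \<theta>) *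
    (muhat y $ i * (if 0 < h y then Dh y $ i else 0) + J y $ i $ i * h y + \<theta> $ i * (muhat y $ i * h y)))" for n y
  note comp = divergence_component_limit[OF nef wm wh K C]
  have S: "integrable lborel (S n)" "(\<lambda>n. LINT y|lborel. S n y) \<longlonglongrightarrow> 0" for n
  proof -
    show "integrable lborel (S n)"
      unfolding S_def[abs_def] by (intro Bochner_Integration.integrable_sum comp(1))
    have "(LINT y|lborel. S n y) = (\<Sum>i\<in>UNIV. LINT y|lborel. cutoff n y * exp (y \<bullet> \<theta>) *
      (muhat y $ i * (if 0 < h y then Dh y $ i else 0) + J y $ i $ i * h y + \<theta> $ i * (muhat y $ i * h y)))" for n
      unfolding S_def by (intro Bochner_Integration.integral_sum comp(1))
    moreover have "(\<lambda>n. \<Sum>i\<in>UNIV. LINT y|lborel. cutoff n y * exp (y \<bullet> \<theta>) *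
      (muhat y $ i * (if 0 < h y then Dh y $ i else 0) + J y $ i $ i * h y + \<theta> $ i * (muhat y $ i * h y)))
      \<longlonglongrightarrow> (\<Sum>i\<in>(UNIV::'d set). 0)"
      by (intro tendsto_sum comp(2))
    ultimately show "(\<lambda>n. LINT y|lborel. S n y) \<longlonglongrightarrow> 0" by simp
  qed
  \<comment> \<open>Where \<open>h y = 0\<close> the density kills the left side, and
    \<open>S n y\<close> vanishes too because the gradient of \<open>h\<close> enters it only where
    \<open>0 < h y\<close>; this is what the restriction in the product rule is for.\<close>
  have dens: "nef_density h A \<theta> y * (cutoff n y * Z y) = exp (- A \<theta>) * S n y" for n y
  proof (cases "h y = 0")
    case False
    then have "0 < h y" using nef_base_nonneg[OF nef, of y] by simp
    then have hZ: "h y * Z y = (\<Sum>i\<in>UNIV. muhat y $ i * (if 0 < h y then Dh y $ i else 0) + J y $ i $ i * h y + \<theta> $ i * (muhat y $ i * h y))"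
      unfolding Z_def sum_distrib_left by (intro sum.cong refl) (simp add: field_simps)
    have "S n y = cutoff n y * exp (y \<bullet> \<theta>) * (h y * Z y)"
      by (simp only: S_def hZ sum_distrib_left)
    then show ?thesis
      by (simp add: nef_density_def exp_diff exp_minus field_simps)
  qed (simp add: nef_density_def S_def)
  have p0: "0 \<le> nef_density h A \<theta> y" for y by (rule nef_density_nonneg[OF nef])
  have cutint: "integrable M (\<lambda>\<omega>. cutoff n (Y \<omega>) * Z (Y \<omega>))" for n
    using distributed_integrable[OF dist, of "\<lambda>y. cutoff n y * Z y"] S(1) p0 by (simp add: dens)
  have "(LINT \<omega>|M. cutoff n (Y \<omega>) * Z (Y \<omega>)) = exp (- A \<theta>) * (LINT y|lborel. S n y)" for n
    using distributed_integral[OF dist, of "\<lambda>y. cutoff n y * Z y"] p0 by (simp add: dens)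
  then have cutlim: "(\<lambda>n. LINT \<omega>|M. cutoff n (Y \<omega>) * Z (Y \<omega>)) \<longlonglongrightarrow> 0"
    using tendsto_mult[OF tendsto_const S(2), of "exp (- A \<theta>)"] by simp
  note cut = integral_0_by_cutoff[of _ M "\<lambda>n \<omega>. cutoff n (Y \<omega>)", OF _ _ cutoff_nonneg cutoff_le_1 cutoff_tendsto]
  show ?thesis
    unfolding MKLS_def
  proof (rule ext_expectation_remove_mean_zero[OF assms(1,9), where Z="\<lambda>\<omega>. Z (Y \<omega>)"])
    show "AE \<omega> in M. SUKLS h Dh A muhat J (Y \<omega>) = nef_KL h A (canonical_link A (muhat (Y \<omega>))) \<theta> - A \<theta> + Z (Y \<omega>)"
      using assms(5)
    proof eventually_elim
      case (elim \<omega>)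
      let ?y = "Y \<omega>" and ?t = "canonical_link A (muhat (Y \<omega>))"
      \<comment> \<open>The estimate lies almost surely in the range of the gradient, and on that
        range \<open>inv\<close> is a right inverse.\<close>
      have "gradient A ?t = muhat ?y"
        using elim by (simp add: canonical_link_def f_inv_into_f)
      then have "nef_KL h A ?t \<theta> = A \<theta> - A ?t - muhat ?y \<bullet> (\<theta> - ?t)"
        by (simp add: nef_KL_eq[OF nef])
      moreover have "Z ?y = ((1 / h ?y) *\<^sub>R Dh ?y) \<bullet> muhat ?y + trace (J ?y) + \<theta> \<bullet> muhat ?y"
        by (simp add: Z_def trace_def inner_vec_def sum.distrib sum_distrib_left)
      ultimately show ?case
        by (simp add: SUKLS_def inner_add_left inner_add_right inner_diff_right inner_commute)
    qed
    show "AE \<omega> in M. 0 \<le> nef_KL h A (canonical_link A (muhat (Y \<omega>))) \<theta>"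
      by (intro AE_I2 nef_KL_nonneg[OF nef])
    assume "(\<integral>\<^sup>+\<omega>. ennreal (Z (Y \<omega>)) \<partial>M) < \<infinity> \<or> (\<integral>\<^sup>+\<omega>. ennreal (- Z (Y \<omega>)) \<partial>M) < \<infinity>"
    then show "integrable M (\<lambda>\<omega>. Z (Y \<omega>)) \<and> (LINT \<omega>|M. Z (Y \<omega>)) = 0"
    proof
      assume "(\<integral>\<^sup>+\<omega>. ennreal (Z (Y \<omega>)) \<partial>M) < \<infinity>"
      then show ?thesis
        by (intro cut cutint cutlim) measurable
    next
      \<comment> \<open>The cutoff criterion asks for a finite positive part, so this alternative is
        reduced to it by passing to \<open>- Z\<close>.\<close>
      assume "(\<integral>\<^sup>+\<omega>. ennreal (- Z (Y \<omega>)) \<partial>M) < \<infinity>"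
      then have "integrable M (\<lambda>\<omega>. - Z (Y \<omega>)) \<and> (LINT \<omega>|M. - Z (Y \<omega>)) = 0"
        using cutint tendsto_minus[OF cutlim] by (intro cut) auto
      then show ?thesis by simp
    qed
  qed measurable
qed

end
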